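(* Let $\alpha\in\mathbb{R}\setminus\{0\}$, $c\in\mathbb{R}$, $f(s)=\sqrt{(e^{\alpha}+s)(e^{-\alpha}+s)}$, $G(s,y)=\frac{cs+y}{f(s)}$ and $W(s,y)=\sup_\sigma\mathbb{E}_y[G(s+\sigma,Y_\sigma)]$ for $(s,y)\in\mathbb{R}_+\times\mathbb{R}$. Let $\mathcal{D}=\{(s,y)\in\mathbb{R}_+\times\mathbb{R}: W(s,y)=G(s,y)\}$. Then there exists a function $b:\mathbb{R}_+\to\mathbb{R}$ such that $\mathcal{D}=\{(s,y): y\geq b(s)\}$. Moreover, $$\frac{c\,(f(s)-sf'(s))}{f'(s)}<b(s)<\infty\qquad\text{for all }s\in\mathbb{R}_+.$$
   Context: $\mathbb{R}_+=[0,\infty)$. Under $\mathbb{P}_y$ (expectation $\mathbb{E}_y$), $Y=\{Y_u\}_{u\geq0}$ is a Brownian motion with $Y_0=y$; the supremum is over all stopping times $\sigma$ of the natural filtration of $Y$, with $G(s+\sigma,Y_\sigma):=c$ on $\{\sigma=\infty\}$ (the a.s. limit of $G(s+u,Y_u)$ as $u\to\infty$). *)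

theory Defs
  imports "HOL-Probability.Probability"
begin

text \<open>
  Processes are functions \<open>real \<Rightarrow> 'a \<Rightarrow> real\<close> of which only the values at times \<open>u \<ge> 0\<close> matter.
  Filtrations are indexed by \<open>ennreal\<close>, so that stopping times range over \<open>[0, \<infinity>]\<close>.
\<close>

definition natural_filtration :: "'a set \<Rightarrow> (real \<Rightarrow> 'a \<Rightarrow> real) \<Rightarrow> ennreal \<Rightarrow> 'a measure" where
  "natural_filtration \<Omega> Y t =
     sigma \<Omega> {Y u -` B \<inter> \<Omega> | u B. 0 \<le> u \<and> ennreal u \<le> t \<and> B \<in> sets borel}"

text \<open>
  All paths are continuous, so \<open>Y\<close> stopped at a stopping time of the uncompleted natural filtration
  is measurable. The initial condition holds only almost surely, so one process on one measurable
  space can start at every point \<open>y\<close> under a family of measures.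
\<close>

locale brownian_motion = prob_space M for M :: "'a measure" +
  fixes Y :: "real \<Rightarrow> 'a \<Rightarrow> real" and y :: real
  assumes measurable_Y: "\<And>u. 0 \<le> u \<Longrightarrow> Y u \<in> borel_measurable M"
    and start: "AE \<omega> in M. Y 0 \<omega> = y"
    and continuous_paths: "\<And>\<omega>. \<omega> \<in> space M \<Longrightarrow> continuous_on {0..} (\<lambda>u. Y u \<omega>)"
    and normal_increments: "\<And>u v. 0 \<le> u \<Longrightarrow> u < v \<Longrightarrow>
      distributed M lborel (\<lambda>\<omega>. Y v \<omega> - Y u \<omega>) (normal_density 0 (sqrt (v - u)))"
    and indep_increments: "\<And>u v. 0 \<le> u \<Longrightarrow> u < v \<Longrightarrow>
      indep_set (sets (natural_filtration (space M) Y (ennreal u)))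
        {(\<lambda>\<omega>. Y v \<omega> - Y u \<omega>) -` B \<inter> space M | B. B \<in> sets borel}"

definition f :: "real \<Rightarrow> real \<Rightarrow> real" where
  "f \<alpha> s = sqrt ((exp \<alpha> + s) * (exp (- \<alpha>) + s))"

definition G :: "real \<Rightarrow> real \<Rightarrow> real \<Rightarrow> real \<Rightarrow> real" where
  "G \<alpha> c s y = (c * s + y) / f \<alpha> s"

definition stopped_gain ::
  "real \<Rightarrow> real \<Rightarrow> (real \<Rightarrow> 'a \<Rightarrow> real) \<Rightarrow> real \<Rightarrow> ('a \<Rightarrow> ennreal) \<Rightarrow> 'a \<Rightarrow> real" where
  "stopped_gain \<alpha> c Y s \<sigma> \<omega> =
     (if \<sigma> \<omega> = \<infinity> then c
      else G \<alpha> c (s + enn2real (\<sigma> \<omega>)) (Y (enn2real (\<sigma> \<omega>)) \<omega>))"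

text \<open>
  Since \<open>f \<alpha> s \<ge> 1 + s\<close> for \<open>s \<ge> 0\<close>, the stopped gain is dominated by \<open>\<bar>c\<bar>\<close> plus the integrable
  supremum of \<open>\<bar>Y u\<bar> / (1 + u)\<close> over \<open>u \<ge> 0\<close>, so the Bochner integrals below are proper expectations.
  The supremum is taken in \<open>ereal\<close> to avoid the default value of \<open>Sup\<close> on unbounded sets of reals.
\<close>

definition W ::
  "(real \<Rightarrow> 'a measure) \<Rightarrow> (real \<Rightarrow> 'a \<Rightarrow> real) \<Rightarrow> real \<Rightarrow> real \<Rightarrow> real \<Rightarrow> real \<Rightarrow> ereal" where
  "W P Y \<alpha> c s y =
     (SUP \<sigma>\<in>{\<sigma>. stopping_time (natural_filtration (space (P y)) Y) \<sigma>}.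
        ereal (integral\<^sup>L (P y) (stopped_gain \<alpha> c Y s \<sigma>)))"

definition stopping_set ::
  "(real \<Rightarrow> 'a measure) \<Rightarrow> (real \<Rightarrow> 'a \<Rightarrow> real) \<Rightarrow> real \<Rightarrow> real \<Rightarrow> (real \<times> real) set" where
  "stopping_set P Y \<alpha> c = {(s, y). 0 \<le> s \<and> W P Y \<alpha> c s y = ereal (G \<alpha> c s y)}"

end

theory Submission
  imports Defs
begin

text \<open>
  On a time grid of step \<open>h\<close> the stopping problem is solved by the Bellman recursion with Gaussian
  averaging. The value \<open>W\<close> equals \<open>G\<close> at \<open>(s, y)\<close> iff all these grid values are at most
  \<open>G \<alpha> c s y\<close>: optimal grid rules are stopping times, and conversely the gain of a stopping time is the
  limit of the gains of its grid roundings, with uniform integrability from an \<open>L\<^sup>2\<close> bound. This makes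
  the stopping set accessible to deterministic arguments.

  The grid values have slope at most \<open>1 / f \<alpha> s\<close> in \<open>y\<close>, the slope of \<open>G\<close>, so sections of the
  stopping set are closed and upward closed. They are nonempty because for large \<open>y\<close> there is a
  space-time superharmonic function, quadratic in space, which dominates \<open>G\<close> at all later times and
  touches it at \<open>(s, y)\<close>. The lower bound is the point at which the drift of \<open>G\<close> vanishes. There,
  compare stopping with the rule that stops at \<open>h\<close> or \<open>2 h\<close>, whichever is better given the
  position at time \<open>h\<close>: the choice gains a multiple of \<open>h powr (3/2)\<close> while the drift costs
  at most \<open>O(h\<^sup>2)\<close>.
\<close>

section \<open>The function \<open>f\<close> and Gaussian averages\<close>

lemma f_squared:
  assumes "0 \<le> s"
  shows "(f \<alpha> s)\<^sup>2 = s\<^sup>2 + 2 * cosh \<alpha> * s + 1"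
proof -
  have "(exp \<alpha> + s) * (exp (- \<alpha>) + s) = s\<^sup>2 + 2 * cosh \<alpha> * s + exp \<alpha> * exp (- \<alpha>)"
    by (simp add: cosh_def algebra_simps power2_eq_square)
  then show ?thesis
    using assms by (simp add: f_def exp_minus)
qed

lemma f_nonneg: "0 \<le> f \<alpha> s" if "0 \<le> s"
  using that by (simp add: f_def)

text \<open>Completing the square gives \<open>(f \<alpha> s)\<^sup>2 = (s + cosh \<alpha>)\<^sup>2
  - ((cosh \<alpha>)\<^sup>2 - 1)\<close>.\<close>

lemma f_le_add_cosh:
  assumes "0 \<le> s"
  shows "f \<alpha> s \<le> s + cosh \<alpha>"
proof (rule power2_le_imp_le)
  have "1 \<le> (cosh \<alpha>)\<^sup>2"
    using cosh_real_ge_1[of \<alpha>] by simp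
  then show "(f \<alpha> s)\<^sup>2 \<le> (s + cosh \<alpha>)\<^sup>2"
    using assms by (simp add: f_squared power2_sum)
  show "0 \<le> s + cosh \<alpha>"
    using assms cosh_real_ge_1[of \<alpha>] by linarith
qed

text \<open>The derivative \<open>(s + cosh \<alpha>) / f \<alpha> s\<close> is at least 1;
  comparing squares gives the same bound without calculus. It is what converts a time step
  \<open>h\<close> into an increment of \<open>f\<close>, so that losses over grid steps
  telescope.\<close>

lemma f_increment:
  assumes "0 \<le> s" "s \<le> t"
  shows "t - s \<le> f \<alpha> t - f \<alpha> s"
proof -
  have "f \<alpha> s + (t - s) \<le> f \<alpha> t"
  proof (rule power2_le_imp_le)
    have "(t - s) * f \<alpha> s \<le> (t - s) * (s + cosh \<alpha>)"
      using assms f_le_add_cosh by (intro mult_left_mono) auto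
    then have "(f \<alpha> s)\<^sup>2 + 2 * ((t - s) * f \<alpha> s) + (t - s)\<^sup>2 
        \<le> (s\<^sup>2 + 2 * cosh \<alpha> * s + 1) + 2 * ((t - s) * (s + cosh \<alpha>)) + (t - s)\<^sup>2"
      using assms by (simp add: f_squared)
    also have "\<dots> = t\<^sup>2 + 2 * cosh \<alpha> * t + 1"
      by (simp add: power2_eq_square algebra_simps)
    also have "\<dots> = (f \<alpha> t)\<^sup>2"
      using assms by (simp add: f_squared)
    finally show "(f \<alpha> s + (t - s))\<^sup>2 \<le> (f \<alpha> t)\<^sup>2"
      by (simp add: power2_sum mult_ac)
  qed (use assms f_nonneg in auto)
  then show ?thesis by simp
qed

lemma f_ge_add_one: "1 + s \<le> f \<alpha> s" if "0 \<le> s"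
proof -
  have "f \<alpha> 0 = 1"
    by (simp add: f_def exp_minus)
  then show ?thesis
    using f_increment[of 0 s \<alpha>] that by simp
qed

lemma f_ge_1: "1 \<le> f \<alpha> s" if "0 \<le> s"
  using f_ge_add_one[OF that, of \<alpha>] that by linarith

lemma f_pos: "0 < f \<alpha> s" if "0 \<le> s"
  using f_ge_1[OF that, of \<alpha>] by linarith

lemma f_mono: "f \<alpha> s \<le> f \<alpha> t" if "0 \<le> s" "s \<le> t"
  using f_increment[OF that, of \<alpha>] that by linarith

lemma continuous_f: "continuous_on {0..} (f \<alpha>)"
  unfolding f_def by (intro continuous_intros)

lemma deriv_f:
  assumes "0 \<le> s"
  shows "deriv (f \<alpha>) s = (s + cosh \<alpha>) / f \<alpha> s"
proof (rule DERIV_imp_deriv)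
  have pos: "0 < (exp \<alpha> + s) * (exp (- \<alpha>) + s)"
    using assms by (intro mult_pos_pos add_pos_nonneg) auto
  have "((\<lambda>s. (exp \<alpha> + s) * (exp (- \<alpha>) + s)) has_real_derivative (2 * (s + cosh \<alpha>))) (at s)"
    by (auto intro!: derivative_eq_intros simp: cosh_def)
  then have D: "((\<lambda>s. sqrt ((exp \<alpha> + s) * (exp (- \<alpha>) + s))) has_real_derivative
      (inverse (f \<alpha> s) / 2 * (2 * (s + cosh \<alpha>)))) (at s)"
    unfolding f_def by (rule DERIV_chain2[where f = sqrt and g = "\<lambda>s. (exp \<alpha> + s) * (exp (- \<alpha>) + s)", OF DERIV_real_sqrt[OF pos]])
  have eq: "f \<alpha> = (\<lambda>s. sqrt ((exp \<alpha> + s) * (exp (- \<alpha>) + s)))"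
    by (rule ext) (rule f_def)
  have "inverse a / 2 * (2 * b) = b / a" for a b :: real
    by (simp add: field_simps)
  with D show "(f \<alpha> has_real_derivative (s + cosh \<alpha>) / f \<alpha> s) (at s)"
    unfolding eq[symmetric] by metis
qed

lemma G_diff: "G \<alpha> c s x - G \<alpha> c s y = (x - y) / f \<alpha> s"
  by (simp add: G_def diff_divide_distrib[symmetric])

lemma G_shift: "G \<alpha> c s (x + z) = G \<alpha> c s x + z / f \<alpha> s"
  by (simp add: G_def add_divide_distrib[symmetric] algebra_simps)

lemma G_affine: "G \<alpha> c t = (\<lambda>x. inverse (f \<alpha> t) * x + c * t / f \<alpha> t)"
  by (rule ext) (simp add: G_def divide_inverse algebra_simps)

section \<open>Gaussian averages of functions of quadratic growth\<close>

definition gauss :: "real \<Rightarrow> real measure" where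
  "gauss h = density lborel (\<lambda>x. ennreal (normal_density 0 (sqrt h) x))"

text \<open>The transition operator of Brownian motion over time \<open>h\<close>.\<close>

definition heat :: "real \<Rightarrow> (real \<Rightarrow> real) \<Rightarrow> real \<Rightarrow> real" where
  "heat h g x = (\<integral>z. g (x + z) \<partial>gauss h)"

text \<open>This class contains the gains, the grid values and the quadratic majorants, and two
  Gaussian moments suffice for its integrability.\<close>

definition quadratic_growth :: "(real \<Rightarrow> real) \<Rightarrow> bool" where
  "quadratic_growth g \<longleftrightarrow> g \<in> borel_measurable borel \<and> (\<exists>K. \<forall>x. \<bar>g x\<bar> \<le> K * (1 + x\<^sup>2))"

lemma sets_gauss [simp, measurable_cong]: "sets (gauss h) = sets borel"
  by (simp add: gauss_def)

lemma space_gauss [simp]: "space (gauss h) = UNIV"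
  by (simp add: gauss_def)

lemma prob_space_gauss: "0 < h \<Longrightarrow> prob_space (gauss h)"
  unfolding gauss_def by (rule prob_space_normal_density) simp

lemma integrable_gauss_iff:
  fixes g :: "real \<Rightarrow> real"
  assumes "g \<in> borel_measurable borel"
  shows "integrable (gauss h) g \<longleftrightarrow> integrable lborel (\<lambda>x. normal_density 0 (sqrt h) x * g x)"
  unfolding gauss_def using assms
  by (subst integrable_density) auto

lemma integral_gauss:
  fixes g :: "real \<Rightarrow> real"
  assumes "g \<in> borel_measurable borel"
  shows "(\<integral>z. g z \<partial>gauss h) = (\<integral>x. normal_density 0 (sqrt h) x * g x \<partial>lborel)"
  unfolding gauss_def using assms
  by (subst integral_density) auto

lemma gauss_moments:
  assumes "0 < h"
  shows "integrable (gauss h) (\<lambda>z. z)" "(\<integral>z. z \<partial>gauss h) = 0"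
    and "integrable (gauss h) (\<lambda>z. z\<^sup>2)" "(\<integral>z. z\<^sup>2 \<partial>gauss h) = h"
    and "(\<integral>z. \<bar>z\<bar> \<partial>gauss h) = sqrt h * sqrt (2 / pi)"
  using assms integrable_normal_moment[of "sqrt h" 0 1] integrable_normal_moment[of "sqrt h" 0 2]
    integral_normal_moment_odd[of "sqrt h" 0 0] integral_normal_moment_even[of "sqrt h" 0 1]
    integral_normal_moment_abs_odd[of "sqrt h" 0 0]
  by (simp_all add: integrable_gauss_iff integral_gauss)

lemma quadratic_growthI:
  "g \<in> borel_measurable borel \<Longrightarrow> (\<And>x. \<bar>g x\<bar> \<le> K * (1 + x\<^sup>2)) \<Longrightarrow> quadratic_growth g"
  unfolding quadratic_growth_def by blast

lemma quadratic_growth_measurable: "quadratic_growth g \<Longrightarrow> g \<in> borel_measurable borel"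
  unfolding quadratic_growth_def by blast

lemma quadratic_growth_bound:
  assumes "quadratic_growth g"
  obtains K where "0 \<le> K" "\<And>x. \<bar>g x\<bar> \<le> K * (1 + x\<^sup>2)"
proof -
  obtain K where K: "\<And>x. \<bar>g x\<bar> \<le> K * (1 + x\<^sup>2)"
    using assms unfolding quadratic_growth_def by blast
  moreover have "0 \<le> K"
    using K[of 0] by simp
  ultimately show thesis
    using that by blast
qed

lemma square_add_le: "(x + z)\<^sup>2 \<le> 2 * x\<^sup>2 + 2 * (z :: real)\<^sup>2"
  using zero_le_power2[of "x - z"] by (simp add: power2_sum power2_diff)

lemma quadratic_growth_integrable:
  assumes "quadratic_growth g" and "0 < h"
  shows "integrable (gauss h) (\<lambda>z. g (x + z))"
proof -
  interpret prob_space "gauss h"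
    using assms(2) by (rule prob_space_gauss)
  obtain K where K: "0 \<le> K" "\<And>x. \<bar>g x\<bar> \<le> K * (1 + x\<^sup>2)"
    using quadratic_growth_bound[OF assms(1)] by blast
  have [measurable]: "g \<in> borel_measurable borel"
    using assms(1) by (rule quadratic_growth_measurable)
  have "integrable (gauss h) (\<lambda>z. K * (1 + 2 * x\<^sup>2 + 2 * z\<^sup>2))"
    using gauss_moments(3)[OF assms(2)] by simp
  moreover have "\<bar>g (x + z)\<bar> \<le> K * (1 + 2 * x\<^sup>2 + 2 * z\<^sup>2)" for z
    using K(2)[of "x + z"] mult_left_mono[OF square_add_le[of x z] K(1)] by (simp add: algebra_simps)
  moreover have "(\<lambda>z. g (x + z)) \<in> borel_measurable (gauss h)"
    by measurable
  ultimately show ?thesis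
    by (elim Bochner_Integration.integrable_bound) (auto intro: order_trans[OF _ abs_ge_self])
qed

lemma lipschitz_quadratic_growth:
  fixes g :: "real \<Rightarrow> real"
  assumes "\<And>x y. \<bar>g x - g y\<bar> \<le> L * \<bar>x - y\<bar>"
  shows "quadratic_growth g"
proof (rule quadratic_growthI)
  have L: "0 \<le> L"
    using assms[of 1 0] by simp
  then have "L-lipschitz_on UNIV g"
    using assms by (auto simp: lipschitz_on_def dist_real_def)
  then show "g \<in> borel_measurable borel"
    by (intro borel_measurable_continuous_onI lipschitz_on_continuous_on)
  fix x :: real
  have "\<bar>g x\<bar> \<le> \<bar>g 0\<bar> + L * \<bar>x\<bar>"
    using assms[of x 0] by simp
  also have "\<dots> \<le> \<bar>g 0\<bar> * (1 + x\<^sup>2) + L * (1 + x\<^sup>2)"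
  proof (intro add_mono mult_left_mono)
    show "\<bar>x\<bar> \<le> 1 + x\<^sup>2"
      using zero_le_power2[of "\<bar>x\<bar> - 1"] by (simp add: power2_diff)
  qed (use L in \<open>auto simp: algebra_simps\<close>)
  finally show "\<bar>g x\<bar> \<le> (\<bar>g 0\<bar> + L) * (1 + x\<^sup>2)"
    by (simp add: algebra_simps)
qed

lemma quadratic_growth_quadratic:
  "quadratic_growth (\<lambda>x. a * (x + m)\<^sup>2 + b)"
proof (rule quadratic_growthI)
  fix x :: real
  have "\<bar>a * (x + m)\<^sup>2 + b\<bar> \<le> \<bar>a\<bar> * (x + m)\<^sup>2 + \<bar>b\<bar>"
    by (metis abs_mult abs_power2 abs_triangle_ineq)
  also have "\<dots> \<le> \<bar>a\<bar> * (2 * x\<^sup>2 + 2 * m\<^sup>2) + \<bar>b\<bar>"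
    by (intro add_right_mono mult_left_mono square_add_le) auto
  also have "\<dots> \<le> (\<bar>a\<bar> * (2 + 2 * m\<^sup>2) + \<bar>b\<bar>) * (1 + x\<^sup>2)"
    by (simp add: algebra_simps)
  finally show "\<bar>a * (x + m)\<^sup>2 + b\<bar> \<le> (\<bar>a\<bar> * (2 + 2 * m\<^sup>2) + \<bar>b\<bar>) * (1 + x\<^sup>2)" .
qed measurable

lemma heat_mono:
  assumes "quadratic_growth g" "quadratic_growth g'" "0 < h" "\<And>x. g x \<le> g' x"
  shows "heat h g x \<le> heat h g' x"
  unfolding heat_def
  using assms by (intro integral_mono quadratic_growth_integrable) auto

lemma heat_affine:
  assumes "0 < h"
  shows "heat h (\<lambda>x. a * x + b) x = a * x + b"
proof -
  interpret prob_space "gauss h"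
    using assms by (rule prob_space_gauss)
  show ?thesis
    unfolding heat_def using gauss_moments(1,2)[OF assms] prob_space by (simp add: distrib_left)
qed

text \<open>The cross term has mean zero and the square adds the variance \<open>h\<close>. The
  superharmonic functions below are written in exactly this form so that the rule applies to
  them.\<close>

lemma heat_square:
  assumes "0 < h"
  shows "heat h (\<lambda>x. a * (x + m)\<^sup>2 + b) x = a * ((x + m)\<^sup>2 + h) + b"
proof -
  interpret prob_space "gauss h"
    using assms by (rule prob_space_gauss)
  have "(\<lambda>z. a * (x + z + m)\<^sup>2 + b) = (\<lambda>z. (a * (x + m)\<^sup>2 + b) + (2 * a * (x + m)) * z + a * z\<^sup>2)"
    by (rule ext) (simp add: power2_eq_square algebra_simps)
  then show ?thesis
    unfolding heat_def using gauss_moments(1-4)[OF assms] prob_space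
    by (simp add: distrib_left)
qed

section \<open>The Bellman recursion\<close>

text \<open>The value from time \<open>t\<close> and position \<open>x\<close> when stopping is
  allowed at \<open>t\<close>, \<open>t + h\<close>, ..., \<open>t + k * h\<close> and forced at the
  last of these times.\<close>

fun bellman :: "real \<Rightarrow> real \<Rightarrow> real \<Rightarrow> nat \<Rightarrow> real \<Rightarrow> real \<Rightarrow> real" where
  "bellman \<alpha> c h 0 t x = G \<alpha> c t x"
| "bellman \<alpha> c h (Suc k) t x = max (G \<alpha> c t x) (heat h (bellman \<alpha> c h k (t + h)) x)"

lemma quadratic_growth_G: "quadratic_growth (G \<alpha> c t)"
proof -
  have "quadratic_growth (\<lambda>x. inverse (f \<alpha> t) * x + c * t / f \<alpha> t)"
    by (rule lipschitz_quadratic_growth[where L = "\<bar>inverse (f \<alpha> t)\<bar>"])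
      (simp add: abs_mult flip: right_diff_distrib)
  then show ?thesis
    by (simp add: G_affine)
qed

lemma heat_G:
  assumes "0 < h"
  shows "heat h (G \<alpha> c t) x = G \<alpha> c t x"
  using heat_affine[OF assms, of "inverse (f \<alpha> t)" "c * t / f \<alpha> t" x] by (simp add: G_affine)

lemma slope_quadratic_growth:
  fixes g :: "real \<Rightarrow> real"
  assumes "\<And>x y. x \<le> y \<Longrightarrow> 0 \<le> g y - g x \<and> g y - g x \<le> L * (y - x)"
  shows "quadratic_growth g"
proof (rule lipschitz_quadratic_growth)
  fix x y
  show "\<bar>g x - g y\<bar> \<le> L * \<bar>x - y\<bar>"
    using assms[of x y] assms[of y x] by (cases "x \<le> y") auto
qed

text \<open>Averaging preserves bounds on the slope, the bound at time \<open>t + h\<close> is no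
  larger than the one at \<open>t\<close> because \<open>f\<close> increases, and a maximum inherits
  the bounds of its two members. Growth, continuity and upward closed sections of the stopping set
  all follow from this.\<close>

lemma bellman_slope:
  assumes "0 < h" "0 \<le> t" "x \<le> y"
  shows "0 \<le> bellman \<alpha> c h k t y - bellman \<alpha> c h k t x \<and>
    bellman \<alpha> c h k t y - bellman \<alpha> c h k t x \<le> inverse (f \<alpha> t) * (y - x)"
  using assms(2,3)
proof (induction k arbitrary: t x y)
  case 0
  then show ?case
    using f_pos[of t \<alpha>] by (simp add: G_diff divide_inverse mult.commute)
next
  case (Suc k)
  interpret prob_space "gauss h"
    using assms(1) by (rule prob_space_gauss)
  let ?v = "bellman \<alpha> c h k (t + h)"
  have th: "0 \<le> t + h"
    using Suc.prems assms(1) by simp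
  have "quadratic_growth ?v"
    by (rule slope_quadratic_growth[OF Suc.IH[OF th]])
  note int = quadratic_growth_integrable[OF this assms(1)]
  have diff: "heat h ?v y - heat h ?v x = (\<integral>z. ?v (y + z) - ?v (x + z) \<partial>gauss h)"
    unfolding heat_def by (rule Bochner_Integration.integral_diff[symmetric]) (rule int)+
  have slope: "0 \<le> ?v (y + z) - ?v (x + z) \<and> ?v (y + z) - ?v (x + z) \<le> inverse (f \<alpha> (t + h)) * (y - x)" for z
    using Suc.IH[OF th, of "x + z" "y + z"] Suc.prems by simp
  have "0 \<le> heat h ?v y - heat h ?v x"
    unfolding diff using slope by (intro integral_nonneg_AE) auto
  moreover have "heat h ?v y - heat h ?v x \<le> inverse (f \<alpha> (t + h)) * (y - x)"
    unfolding diff using slope prob_space int integral_mono[of "gauss h" "\<lambda>z. ?v (y + z) - ?v (x + z)" "\<lambda>z. inverse (f \<alpha> (t + h)) * (y - x)"]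
    by simp
  moreover have "inverse (f \<alpha> (t + h)) * (y - x) \<le> inverse (f \<alpha> t) * (y - x)"
    using Suc.prems assms(1) f_pos[of t \<alpha>] f_mono[of t "t + h" \<alpha>]
    by (intro mult_right_mono le_imp_inverse_le) auto
  moreover have "G \<alpha> c t y - G \<alpha> c t x = inverse (f \<alpha> t) * (y - x)" "0 \<le> inverse (f \<alpha> t) * (y - x)"
    using f_pos[of t \<alpha>] Suc.prems by (simp_all add: G_diff divide_inverse mult.commute)
  ultimately show ?case
    by (auto simp: max_def)
qed

lemma quadratic_growth_bellman:
  assumes "0 < h" "0 \<le> t"
  shows "quadratic_growth (bellman \<alpha> c h k t)"
  using bellman_slope[OF assms] by (rule slope_quadratic_growth)

lemma continuous_bellman:
  assumes "0 < h" "0 \<le> t"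
  shows "continuous_on UNIV (bellman \<alpha> c h k t)"
proof -
  have "\<bar>bellman \<alpha> c h k t x - bellman \<alpha> c h k t y\<bar> \<le> inverse (f \<alpha> t) * \<bar>x - y\<bar>" for x y
    using bellman_slope[OF assms, of x y \<alpha> c k] bellman_slope[OF assms, of y x \<alpha> c k]
    by (cases "x \<le> y") auto
  then have "(inverse (f \<alpha> t))-lipschitz_on UNIV (bellman \<alpha> c h k t)"
    using f_pos[of t \<alpha>] assms by (auto simp: lipschitz_on_def dist_real_def)
  then show ?thesis
    by (rule lipschitz_on_continuous_on)
qed

lemma G_le_bellman: "G \<alpha> c t x \<le> bellman \<alpha> c h k t x"
  by (cases k) auto

text \<open>The grid value is dominated by every superharmonic majorant of the gain: induction on
  the remaining steps, with monotonicity of the averages.\<close>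

lemma bellman_le_supersolution:
  assumes "0 < h" "0 \<le> t"
    and "\<And>u. t \<le> u \<Longrightarrow> quadratic_growth (\<phi> u)"
    and "\<And>u x. t \<le> u \<Longrightarrow> G \<alpha> c u x \<le> \<phi> u x"
    and "\<And>u x. t \<le> u \<Longrightarrow> heat h (\<phi> (u + h)) x \<le> \<phi> u x"
  shows "bellman \<alpha> c h k t x \<le> \<phi> t x"
  using assms(2-)
proof (induction k arbitrary: t x)
  case 0
  then show ?case by simp
next
  case (Suc k)
  have "bellman \<alpha> c h k (t + h) x \<le> \<phi> (t + h) x" for x
    using Suc.prems assms(1) by (intro Suc.IH) auto
  then have "heat h (bellman \<alpha> c h k (t + h)) x \<le> heat h (\<phi> (t + h)) x"
    using Suc.prems assms(1) by (intro heat_mono quadratic_growth_bellman) auto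
  also have "\<dots> \<le> \<phi> t x"
    using Suc.prems by simp
  finally show ?case
    using Suc.prems by simp
qed

section \<open>A superharmonic majorant touching the gain far up\<close>

text \<open>The right side is the integral of \<open>1 / w ^ 3\<close> with respect to
  \<open>w\<^sup>2\<close> from \<open>u\<close> to \<open>v\<close>; the left side replaces the
  integrand by its smallest value.\<close>

lemma inverse_increment_ge:
  fixes u v :: real
  assumes "0 < u" "u \<le> v"
  shows "(v\<^sup>2 - u\<^sup>2) / v ^ 3 \<le> 2 * (1 / u - 1 / v)"
proof -
  have "2 * (1 / u - 1 / v) - (v\<^sup>2 - u\<^sup>2) / v ^ 3 = (v - u) * (2 * v\<^sup>2 - u * (u + v)) / (u * v ^ 3)"
    using assms by (simp add: field_simps power2_eq_square power3_eq_cube)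
  moreover have "u * (u + v) \<le> v * (v + v)"
    using assms by (intro mult_mono) auto
  then have "0 \<le> (v - u) * (2 * v\<^sup>2 - u * (u + v)) / (u * v ^ 3)"
    using assms by (intro divide_nonneg_nonneg mult_nonneg_nonneg) (auto simp: power2_eq_square)
  ultimately show ?thesis
    by linarith
qed

text \<open>
  The dominating function is \<open>\<phi> t\<close>. Young's inequality bounds \<open>(x + m) / f \<alpha> t\<close> by
  \<open>q t / (2 * M) * (x + m)\<^sup>2 + M / (2 * q t * (f \<alpha> t)\<^sup>2)\<close>, with equality at the starting point if
  \<open>q s = 1 / (f \<alpha> s)\<^sup>2\<close>; choosing \<open>q\<close> to decay like \<open>f\<close> to the power \<open>- 3 / 2\<close> keeps it integrable,
  so the compensator \<open>p\<close> stays bounded, yet lets the last term decrease fast enough to pay for \<open>p\<close>.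
\<close>

lemma stop_far_up:
  assumes "0 \<le> s"
  shows "\<exists>y. \<forall>h>0. \<forall>k. bellman \<alpha> c h k s y \<le> G \<alpha> c s y"
proof -
  \<comment> \<open>Chosen so that \<open>M / 2 - 2 * \<bar>c\<bar> = 1\<close>, which balances the
    budget at the end of \<open>dominates\<close>.\<close>
  define M where "M = 4 * \<bar>c\<bar> + 2"
  \<comment> \<open>With this shift,
    \<open>G \<alpha> c s x - c = (x + m) / f \<alpha> s\<close>.\<close>
  define m where "m = c * (s - f \<alpha> s)"
  define r where "r t = sqrt (f \<alpha> t)" for t
  define q where "q t = 1 / (r s * r t ^ 3)" for t
  \<comment> \<open>It vanishes at \<open>s\<close>, and its decrease over a step pays for the
    variance term \<open>q (t + h) * h\<close> produced by averaging.\<close>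
  define p where "p t = - (2 / r s * (1 / r s - 1 / r t))" for t
  define \<phi> where "\<phi> t x = q t / (2 * M) * (x + m)\<^sup>2 + (c + M / 2 + p t / (2 * M))" for t x
  have M: "2 \<le> M"
    by (simp add: M_def)
  have r1: "1 \<le> r t" if "s \<le> t" for t
    using f_ge_1[of t \<alpha>] that assms by (simp add: r_def)
  have r_mono: "r t \<le> r u" if "s \<le> t" "t \<le> u" for t u
    using f_mono[of t u \<alpha>] that assms by (simp add: r_def)
  have r2: "(r t)\<^sup>2 = f \<alpha> t" if "s \<le> t" for t
    using f_nonneg[of t \<alpha>] that assms by (simp add: r_def)
  have growth: "quadratic_growth (\<phi> t)" for t
    unfolding \<phi>_def by (rule quadratic_growth_quadratic)
  have decrease: "heat h (\<phi> (t + h)) x \<le> \<phi> t x" if "0 < h" "s \<le> t" for h t x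
  proof -
    have rt: "1 \<le> r t" "r t \<le> r (t + h)" "1 \<le> r s" "1 \<le> r (t + h)"
      using r1[of t] r1[of s] r1[of "t + h"] r_mono[of t "t + h"] that by auto
    have "q (t + h) \<le> q t"
      unfolding q_def using rt by (intro divide_left_mono mult_left_mono power_mono) auto
    then have "q (t + h) * (x + m)\<^sup>2 \<le> q t * (x + m)\<^sup>2"
      by (rule mult_right_mono) simp
    moreover have "q (t + h) * h \<le> p t - p (t + h)"
    proof -
      have "h \<le> (r (t + h))\<^sup>2 - (r t)\<^sup>2"
        using f_increment[of t "t + h" \<alpha>] r2[of t] r2[of "t + h"] that assms by simp
      then have "h / r (t + h) ^ 3 \<le> ((r (t + h))\<^sup>2 - (r t)\<^sup>2) / r (t + h) ^ 3"
        using rt by (intro divide_right_mono) auto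
      also have "\<dots> \<le> 2 * (1 / r t - 1 / r (t + h))"
        using rt by (intro inverse_increment_ge) auto
      finally have "1 / r s * (h / r (t + h) ^ 3) \<le> 1 / r s * (2 * (1 / r t - 1 / r (t + h)))"
        using rt by (intro mult_left_mono) auto
      then show ?thesis
        by (simp add: q_def p_def algebra_simps)
    qed
    ultimately have "(q (t + h) * ((x + m)\<^sup>2 + h) + p (t + h)) / (2 * M) \<le> (q t * (x + m)\<^sup>2 + p t) / (2 * M)"
      using M by (intro divide_right_mono) (auto simp: algebra_simps)
    then show ?thesis
      unfolding \<phi>_def heat_square[OF that(1)] by (simp add: add_divide_distrib)
  qed
  have dominates: "G \<alpha> c t x \<le> \<phi> t x" if "s \<le> t" for t x
  proof -
    have rt: "1 \<le> r t" "r s \<le> r t" "1 \<le> r s"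
      using r1[of t] r1[of s] r_mono[of s t] that by auto
    define w where "w = r s / r t"
    have w: "0 < w" "w \<le> 1"
      using rt by (auto simp: w_def)
    have ft: "0 < f \<alpha> t"
      using that assms f_pos by simp
    \<comment> \<open>For this \<open>q\<close> the second Young term
      \<open>M / (2 * q t * (f \<alpha> t)\<^sup>2)\<close> equals \<open>M * w / 2\<close>; the
      difference of the two sides is a perfect square.\<close>
    have "q t * (x + m)\<^sup>2 / M + M * w - 2 * (x + m) / f \<alpha> t = ((x + m) / r t - M * r s)\<^sup>2 / (M * r s * r t)"
      using rt M r2[OF that, symmetric]
      by (simp add: q_def w_def power2_eq_square power3_eq_cube divide_simps) (simp add: algebra_simps)
    also have "\<dots> \<ge> 0"
      using rt M by simp
    finally have young: "(x + m) / f \<alpha> t \<le> q t / (2 * M) * (x + m)\<^sup>2 + M * w / 2"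
      by (simp add: field_simps)
    \<comment> \<open>After time \<open>s\<close> the shift \<open>m\<close> no longer absorbs
      \<open>c * t\<close> exactly. The remainder is controlled by the growth of \<open>f\<close>,
      hence by \<open>1 - w\<close>.\<close>
    have "c * ((t - s) - (f \<alpha> t - f \<alpha> s)) \<le> \<bar>c\<bar> * (f \<alpha> t - f \<alpha> s)"
    proof -
      have "c * ((t - s) - (f \<alpha> t - f \<alpha> s)) \<le> \<bar>c\<bar> * \<bar>(t - s) - (f \<alpha> t - f \<alpha> s)\<bar>"
        by (metis abs_ge_self abs_mult)
      also have "\<dots> \<le> \<bar>c\<bar> * (f \<alpha> t - f \<alpha> s)"
        using f_increment[of s t \<alpha>] that assms by (intro mult_left_mono) auto
      finally show ?thesis .
    qed
    then have "c * ((t - s) - (f \<alpha> t - f \<alpha> s)) / f \<alpha> t \<le> \<bar>c\<bar> * (f \<alpha> t - f \<alpha> s) / f \<alpha> t"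
      using ft by (intro divide_right_mono) auto
    also have "\<dots> = \<bar>c\<bar> * (1 - w\<^sup>2)"
      using ft r2[of s] r2[OF that] by (simp add: w_def power_divide field_simps)
    also have "\<dots> \<le> \<bar>c\<bar> * (2 * (1 - w))"
      using zero_le_power2[of "1 - w"] by (intro mult_left_mono) (auto simp: power2_diff)
    finally have drift: "c * ((t - s) - (f \<alpha> t - f \<alpha> s)) / f \<alpha> t \<le> 2 * \<bar>c\<bar> * (1 - w)"
      by (simp add: algebra_simps)
    have "p t = - (2 * (1 - w) / (r s)\<^sup>2)"
      using rt by (simp add: p_def w_def field_simps power2_eq_square)
    moreover have "2 * (1 - w) / (r s)\<^sup>2 \<le> 2 * (1 - w) / 1"
      using rt w by (intro divide_left_mono) auto
    ultimately have "- (2 * (1 - w)) \<le> p t"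
      by linarith
    then have "- (2 * (1 - w)) / (2 * M) \<le> p t / (2 * M)"
      using M by (intro divide_right_mono) auto
    moreover have "(1 - w) / M \<le> (1 - w) / 1"
      using M w by (intro divide_left_mono) auto
    moreover have "- (2 * (1 - w)) / (2 * M) = - ((1 - w) / M)"
      using M by (simp add: field_simps)
    ultimately have "- (1 - w) \<le> p t / (2 * M)"
      by simp
    \<comment> \<open>As \<open>w\<close> falls below 1, the Young term falls enough to pay for the
      drift and leaves \<open>1 - w\<close>, which covers the negative compensator
      \<open>p t / (2 * M)\<close>.\<close>
    moreover have "M * w / 2 + 2 * \<bar>c\<bar> * (1 - w) = M / 2 - (1 - w)"
      by (simp add: M_def field_simps)
    ultimately have "(x + m) / f \<alpha> t + c * ((t - s) - (f \<alpha> t - f \<alpha> s)) / f \<alpha> t \<le> \<phi> t x - c"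
      using young drift unfolding \<phi>_def by linarith
    moreover have "G \<alpha> c t x = c + ((x + m) / f \<alpha> t + c * ((t - s) - (f \<alpha> t - f \<alpha> s)) / f \<alpha> t)"
      using ft by (simp add: G_def m_def field_simps)
    ultimately show ?thesis
      by linarith
  qed
  \<comment> \<open>The point where the square in Young's inequality vanishes at
    \<open>t = s\<close>, so the majorant touches \<open>G\<close> there with common value
    \<open>c + M\<close>.\<close>
  define y where "y = M * f \<alpha> s - m"
  have "bellman \<alpha> c h k s y \<le> G \<alpha> c s y" if "0 < h" for h k
  proof -
    have "bellman \<alpha> c h k s y \<le> \<phi> s y"
      using that assms growth dominates decrease by (intro bellman_le_supersolution) auto
    also have "\<phi> s y = c + M"
    proof -
      have "q s * (f \<alpha> s)\<^sup>2 = 1"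
        using r1[of s] r2[of s, symmetric] by (simp add: q_def power2_eq_square power3_eq_cube)
      then show ?thesis
        using M by (simp add: \<phi>_def y_def p_def power_mult_distrib) (simp add: field_simps power2_eq_square)
    qed
    also have "\<dots> = G \<alpha> c s y"
      using f_pos[OF assms, of \<alpha>] by (simp add: G_def y_def m_def field_simps)
    finally show ?thesis .
  qed
  then show ?thesis by blast
qed

section \<open>Strict gain from waiting at zero drift\<close>

lemma continue_at_zero_drift:
  assumes "0 \<le> s" and y: "y = c * (f \<alpha> s - s * deriv (f \<alpha>) s) / deriv (f \<alpha>) s"
  shows "\<exists>h>0. G \<alpha> c s y < bellman \<alpha> c h 2 s y"
proof -
  define D where "D = s + cosh \<alpha>"
  define K where "K = \<bar>c\<bar> * ((cosh \<alpha>)\<^sup>2 - 1)"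
  \<comment> \<open>Since \<open>h \<le> 1\<close>, both later values of \<open>f\<close> are at
    most \<open>f \<alpha> (s + 2)\<close>; hence \<open>\<kappa> * h\<close> bounds the difference
    of the slopes of \<open>G\<close> at the two times from below.\<close>
  define \<kappa> where "\<kappa> = 1 / (f \<alpha> (s + 2))\<^sup>2"
  \<comment> \<open>The mean absolute value of a standard normal variable.\<close>
  define \<mu> where "\<mu> = sqrt (2 / pi)"
  \<comment> \<open>Here \<open>r\<close> is the root of the time step. The choice gains at least
    \<open>\<kappa> * \<mu> * r ^ 3 / 2\<close> and drift costs at most
    \<open>5 * K * r ^ 4\<close>; the added 1 keeps the denominator positive and makes the
    comparison strict.\<close>
  define r where "r = min 1 (\<kappa> * \<mu> / (10 * K + 1))"
  define h where "h = r\<^sup>2"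
  have D1: "1 \<le> D"
    using assms(1) cosh_real_ge_1[of \<alpha>] by (simp add: D_def)
  have C1: "1 \<le> (cosh \<alpha>)\<^sup>2"
    using cosh_real_ge_1[of \<alpha>] by simp
  then have K0: "0 \<le> K"
    by (simp add: K_def)
  have "0 < \<kappa>" "0 < \<mu>"
    using f_pos[of "s + 2" \<alpha>] assms(1) by (auto simp: \<kappa>_def \<mu>_def)
  then have r: "0 < r" "r \<le> 1" "r \<le> \<kappa> * \<mu> / (10 * K + 1)"
    using K0 by (auto simp: r_def)
  have h: "0 < h" "h \<le> 1" "sqrt h = r"
    using r by (auto simp: h_def power_le_one)
  have fs: "0 < f \<alpha> s"
    using f_pos assms(1) by simp
  \<comment> \<open>The vanishing of the time derivative of \<open>G\<close>, in a form free of
    \<open>deriv\<close>.\<close>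
  have ycs: "y + c * s = c * (f \<alpha> s)\<^sup>2 / D"
    unfolding y deriv_f[OF assms(1)] D_def[symmetric]
    using D1 fs by (simp add: field_simps power2_eq_square)
  have flat: "\<bar>G \<alpha> c (s + \<tau>) y - G \<alpha> c s y\<bar> \<le> K * \<tau>\<^sup>2" if "0 \<le> \<tau>" for \<tau>
  proof -
    define S where "S = f \<alpha> s"
    define T where "T = f \<alpha> (s + \<tau>)"
    have ST: "1 \<le> S" "1 \<le> T"
      using f_ge_1[of s \<alpha>] f_ge_1[of "s + \<tau>" \<alpha>] assms(1) that by (auto simp: S_def T_def)
    have S2: "S\<^sup>2 = D\<^sup>2 - ((cosh \<alpha>)\<^sup>2 - 1)"
      using assms(1) by (simp add: S_def D_def f_squared power2_sum)
    have T2: "T\<^sup>2 = S\<^sup>2 + 2 * \<tau> * D + \<tau>\<^sup>2"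
      using assms(1) that by (simp add: S_def T_def D_def f_squared) (simp add: power2_eq_square algebra_simps)
    \<comment> \<open>The factor that rationalises \<open>(S\<^sup>2 + \<tau> * D) / T - S\<close>:
      it clears the denominator and multiplies by the conjugate. The terms linear in
      \<open>\<tau>\<close> cancel, leaving a multiple of \<open>\<tau>\<^sup>2\<close>.\<close>
    define N where "N = T * (S\<^sup>2 + \<tau> * D + S * T)"
    have "1 * (1 + 0 + 0) \<le> N"
      unfolding N_def using ST D1 that by (intro mult_mono add_mono) auto
    then have N: "1 \<le> N" by simp
    have "(S\<^sup>2 + \<tau> * D)\<^sup>2 - S\<^sup>2 * T\<^sup>2 = \<tau>\<^sup>2 * (D\<^sup>2 - S\<^sup>2)"
      unfolding T2 by (simp add: power2_eq_square algebra_simps)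
    also have "D\<^sup>2 - S\<^sup>2 = (cosh \<alpha>)\<^sup>2 - 1"
      using S2 by simp
    finally have "((S\<^sup>2 + \<tau> * D) - S * T) * ((S\<^sup>2 + \<tau> * D) + S * T) = \<tau>\<^sup>2 * ((cosh \<alpha>)\<^sup>2 - 1)"
      by (simp add: power2_eq_square algebra_simps)
    moreover have "((S\<^sup>2 + \<tau> * D) / T - S) * T = (S\<^sup>2 + \<tau> * D) - S * T"
      using ST by (simp add: left_diff_distrib)
    ultimately have "((S\<^sup>2 + \<tau> * D) / T - S) * N = \<tau>\<^sup>2 * ((cosh \<alpha>)\<^sup>2 - 1)"
      unfolding N_def by (metis mult.assoc)
    then have eq: "(S\<^sup>2 + \<tau> * D) / T - S = \<tau>\<^sup>2 * ((cosh \<alpha>)\<^sup>2 - 1) / N"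
      using N by (simp add: field_simps)
    have "G \<alpha> c (s + \<tau>) y - G \<alpha> c s y = (c * S\<^sup>2 / D + c * \<tau>) / T - (c * S\<^sup>2 / D) / S"
      using ycs by (simp add: G_def S_def T_def algebra_simps)
    also have "\<dots> = c / D * ((S\<^sup>2 + \<tau> * D) / T - S)"
      using ST D1 by (simp add: field_simps power2_eq_square)
    also have "\<bar>\<dots>\<bar> = \<bar>c\<bar> * \<tau>\<^sup>2 * ((cosh \<alpha>)\<^sup>2 - 1) / (D * N)"
      unfolding eq using D1 N C1 by (simp add: abs_mult)
    also have "\<dots> \<le> \<bar>c\<bar> * \<tau>\<^sup>2 * ((cosh \<alpha>)\<^sup>2 - 1) / 1"
      using D1 N C1 mult_mono[of 1 D 1 N] by (intro divide_left_mono mult_nonneg_nonneg) auto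
    finally show ?thesis
      by (simp add: K_def mult_ac)
  qed
  define F1 where "F1 = f \<alpha> (s + h)"
  define F2 where "F2 = f \<alpha> (s + h + h)"
  define g1 where "g1 = G \<alpha> c (s + h) y"
  define g2 where "g2 = G \<alpha> c (s + h + h) y"
  define B where "B = 1 / F1 - 1 / F2"
  have F: "0 < F1" "0 < F2" "F1 \<le> f \<alpha> (s + 2)" "F2 \<le> f \<alpha> (s + 2)" "h \<le> F2 - F1"
    using assms(1) h f_increment[of "s + h" "s + h + h" \<alpha>] unfolding F1_def F2_def
    by (auto intro!: f_pos f_mono)
  have B: "\<kappa> * h \<le> B"
  proof -
    have "\<kappa> * h = h / (f \<alpha> (s + 2))\<^sup>2"
      by (simp add: \<kappa>_def)
    also have "\<dots> \<le> (F2 - F1) / (F1 * F2)"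
      unfolding power2_eq_square using F h by (intro frac_le mult_mono) auto
    also have "\<dots> = B"
      using F by (simp add: B_def field_simps)
    finally show ?thesis .
  qed
  have B0: "0 \<le> B"
    using B h \<open>0 < \<kappa>\<close> by (meson less_imp_le mult_nonneg_nonneg order_trans)
  have g: "\<bar>g1 - G \<alpha> c s y\<bar> \<le> K * h\<^sup>2" "\<bar>g2 - G \<alpha> c s y\<bar> \<le> 4 * (K * h\<^sup>2)"
    using flat[of h] flat[of "h + h"] h by (auto simp: g1_def g2_def power2_eq_square algebra_simps)
  interpret prob_space "gauss h"
    using h(1) by (rule prob_space_gauss)
  have th: "0 \<le> s + h"
    using assms(1) h by simp
  let ?v = "bellman \<alpha> c h 1 (s + h)"
  \<comment> \<open>A minorant of the value at time \<open>h\<close> with an explicit mean: write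
    the maximum of two gains as half their sum plus half their distance, and apply the reverse
    triangle inequality. The term in \<open>z\<close> averages to zero and
    \<open>\<bar>z\<bar>\<close> to \<open>r * \<mu>\<close>.\<close>
  let ?l = "\<lambda>z. (g1 + g2) / 2 - \<bar>g1 - g2\<bar> / 2 + (1 / F1 + 1 / F2) / 2 * z + B / 2 * \<bar>z\<bar>"
  have bellman_0: "bellman \<alpha> c h 0 t = G \<alpha> c t" for t
    by (rule ext) simp
  have "?l z \<le> ?v (y + z)" for z
  proof -
    \<comment> \<open>Averaging fixes the affine function \<open>G\<close>, so only the choice
      between the two times remains.\<close>
    have "?v (y + z) = max (G \<alpha> c (s + h) (y + z)) (G \<alpha> c (s + h + h) (y + z))"
      by (simp only: One_nat_def bellman.simps bellman_0 heat_G[OF h(1)])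
    also have "\<dots> = max (g1 + z / F1) (g2 + z / F2)"
      by (simp add: G_shift g1_def g2_def F1_def F2_def)
    also have "\<dots> = ((g1 + z / F1) + (g2 + z / F2)) / 2 + \<bar>(g1 + z / F1) - (g2 + z / F2)\<bar> / 2"
      by (simp add: max_def field_simps)
    also have "(g1 + z / F1) - (g2 + z / F2) = (g1 - g2) + B * z"
      by (simp add: B_def field_simps)
    finally have "?v (y + z) = ((g1 + z / F1) + (g2 + z / F2)) / 2 + \<bar>(g1 - g2) + B * z\<bar> / 2" .
    moreover have "B * \<bar>z\<bar> - \<bar>g1 - g2\<bar> \<le> \<bar>(g1 - g2) + B * z\<bar>"
      using B0 by (simp add: abs_mult[of B z, symmetric, simplified abs_of_nonneg[OF B0]])
    moreover have "(1 / F1 + 1 / F2) / 2 * z = (z / F1 + z / F2) / 2"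
      by (simp add: distrib_right)
    ultimately show ?thesis
      by argo
  qed
  then have "(\<integral>z. ?l z \<partial>gauss h) \<le> heat h ?v y"
    unfolding heat_def using gauss_moments[OF h(1)] h th
    by (intro integral_mono quadratic_growth_integrable quadratic_growth_bellman) auto
  also have "\<dots> \<le> bellman \<alpha> c h 2 s y"
    by (simp add: numeral_2_eq_2)
  also have "(\<integral>z. ?l z \<partial>gauss h) = (g1 + g2) / 2 - \<bar>g1 - g2\<bar> / 2 + B / 2 * (r * \<mu>)"
    using gauss_moments[OF h(1)] prob_space h by (simp add: \<mu>_def)
  finally have "(g1 + g2) / 2 - \<bar>g1 - g2\<bar> / 2 + B / 2 * (r * \<mu>) \<le> bellman \<alpha> c h 2 s y" .
  then have "(g1 + g2) / 2 - \<bar>g1 - g2\<bar> / 2 + B * (r * \<mu>) / 2 \<le> bellman \<alpha> c h 2 s y"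
    by simp
  \<comment> \<open>The two drift errors, \<open>K * h\<^sup>2\<close> and
    \<open>4 * (K * h\<^sup>2)\<close>, enter once through the mean of \<open>g1\<close> and
    \<open>g2\<close> and once through their distance, \<open>5 * (K * h\<^sup>2)\<close> each time
    before halving.\<close>
  moreover have "10 * (K * h\<^sup>2) < B * (r * \<mu>)"
  proof -
    have "10 * K * r < (10 * K + 1) * r"
      using r by (simp add: algebra_simps)
    also have "\<dots> \<le> (10 * K + 1) * (\<kappa> * \<mu> / (10 * K + 1))"
      using r K0 by (intro mult_left_mono) auto
    also have "\<dots> = \<kappa> * \<mu>"
      using K0 by simp
    finally have "10 * K * r * (h * r) < \<kappa> * \<mu> * (h * r)"
      using h r by (intro mult_strict_right_mono) auto
    also have "\<dots> \<le> B * (r * \<mu>)"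
      using mult_right_mono[OF B, of "r * \<mu>"] r \<open>0 < \<mu>\<close> by (simp add: mult_ac)
    finally show ?thesis
      by (simp add: h_def power2_eq_square mult_ac)
  qed
  moreover have "\<bar>g1 - g2\<bar> \<le> 5 * (K * h\<^sup>2)" "G \<alpha> c s y - K * h\<^sup>2 \<le> g1"
      "G \<alpha> c s y - 4 * (K * h\<^sup>2) \<le> g2"
    using g by linarith+
  ultimately have "G \<alpha> c s y < bellman \<alpha> c h 2 s y"
    by argo
  then show ?thesis
    using h by blast
qed

section \<open>Stopping on a time grid\<close>

lemma space_natural_filtration [simp]: "space (natural_filtration \<Omega> Y t) = \<Omega>"
  by (auto simp: natural_filtration_def space_measure_of_conv)

lemma sets_natural_filtration:
  "sets (natural_filtration \<Omega> Y t) =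
    sigma_sets \<Omega> {Y u -` B \<inter> \<Omega> | u B. 0 \<le> u \<and> ennreal u \<le> t \<and> B \<in> sets borel}"
  unfolding natural_filtration_def by (rule sets_measure_of) auto

lemma sets_natural_filtration_mono:
  "t \<le> t' \<Longrightarrow> sets (natural_filtration \<Omega> Y t) \<subseteq> sets (natural_filtration \<Omega> Y t')"
  unfolding sets_natural_filtration by (rule sigma_sets_subseteq) (auto intro: order_trans)

lemma measurable_natural_filtration:
  assumes "0 \<le> u" "ennreal u \<le> t"
  shows "Y u \<in> borel_measurable (natural_filtration \<Omega> Y t)"
  by (rule measurableI) (use assms in \<open>auto simp: sets_natural_filtration intro!: sigma_sets.Basic\<close>)

lemma pred_natural_filtration_mono:
  assumes "Measurable.pred (natural_filtration \<Omega> Y t) Q" "t \<le> t'"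
  shows "Measurable.pred (natural_filtration \<Omega> Y t') Q"
  using assms sets_natural_filtration_mono[OF assms(2), of \<Omega> Y] by (auto simp: pred_def)

lemma quadratic_growth_heat:
  assumes "quadratic_growth g" "0 < h"
  shows "quadratic_growth (heat h g)"
proof -
  interpret prob_space "gauss h"
    using assms(2) by (rule prob_space_gauss)
  have [measurable]: "g \<in> borel_measurable borel"
    using assms(1) by (rule quadratic_growth_measurable)
  obtain K where K: "0 \<le> K" "\<And>x. \<bar>g x\<bar> \<le> K * (1 + x\<^sup>2)"
    using quadratic_growth_bound[OF assms(1)] by blast
  have q: "quadratic_growth (\<lambda>x. K * (x + 0)\<^sup>2 + K)"
    by (rule quadratic_growth_quadratic)
  have bound: "\<bar>heat h g x\<bar> \<le> (K + K * h) * (1 + x\<^sup>2)" for x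
  proof -
    have "\<bar>heat h g x\<bar> \<le> (\<integral>z. \<bar>g (x + z)\<bar> \<partial>gauss h)"
      unfolding heat_def by (rule integral_abs_bound)
    also have "\<dots> \<le> heat h (\<lambda>x. K * (x + 0)\<^sup>2 + K) x"
      unfolding heat_def using K(2)
      by (intro integral_mono integrable_abs quadratic_growth_integrable assms q) (auto simp: algebra_simps)
    also have "\<dots> = K * (x\<^sup>2 + h) + K"
      unfolding heat_square[OF assms(2)] by simp
    also have "\<dots> \<le> (K + K * h) * (1 + x\<^sup>2)"
      using K(1) assms(2) by (simp add: algebra_simps)
    finally show ?thesis .
  qed
  have "(\<lambda>x. \<integral>z. g (x + z) \<partial>gauss h) \<in> borel_measurable borel"
    by measurable
  then have "heat h g \<in> borel_measurable borel"
    by (simp add: heat_def [abs_def])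
  then show ?thesis
    using bound by (rule quadratic_growthI)
qed

text \<open>A first hitting index capped at \<open>N\<close> is adapted: whether it has occurred by
  \<open>k\<close> depends on finitely many events, each already decided by time
  \<open>k * h\<close>. The disjunct \<open>k = N\<close> guarantees that the least index
  exists.\<close>

lemma pred_Least_le:
  fixes N :: nat
  assumes "\<And>k. k < N \<Longrightarrow> Measurable.pred (natural_filtration \<Omega> Y (ennreal (real k * h))) (Q k)"
    and "0 \<le> h"
  shows "Measurable.pred (natural_filtration \<Omega> Y (ennreal (real k * h)))
    (\<lambda>\<omega>. (LEAST k. k = N \<or> Q k \<omega>) \<le> k)"
proof -
  let ?F = "natural_filtration \<Omega> Y (ennreal (real k * h))"
  have least_le_iff: "(LEAST k. k = N \<or> Q k \<omega>) \<le> k \<longleftrightarrow> N \<le> k \<or> (\<exists>i\<in>{i. i \<le> k \<and> i < N}. Q i \<omega>)" for \<omega>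
  proof
    assume *: "(LEAST k. k = N \<or> Q k \<omega>) \<le> k"
    have "(LEAST k. k = N \<or> Q k \<omega>) = N \<or> Q (LEAST k. k = N \<or> Q k \<omega>) \<omega>"
      by (rule LeastI[of "\<lambda>k. k = N \<or> Q k \<omega>" N]) simp
    moreover have "(LEAST k. k = N \<or> Q k \<omega>) \<le> N"
      by (rule Least_le) simp
    ultimately show "N \<le> k \<or> (\<exists>i\<in>{i. i \<le> k \<and> i < N}. Q i \<omega>)"
      using * by (metis (mono_tags, lifting) le_neq_implies_less mem_Collect_eq)
  next
    assume "N \<le> k \<or> (\<exists>i\<in>{i. i \<le> k \<and> i < N}. Q i \<omega>)"
    then obtain i where "i \<le> k" "i = N \<or> Q i \<omega>"
      by blast
    then show "(LEAST k. k = N \<or> Q k \<omega>) \<le> k"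
      using Least_le[of "\<lambda>k. k = N \<or> Q k \<omega>" i] by simp
  qed
  have eq: "(\<lambda>\<omega>. (LEAST k. k = N \<or> Q k \<omega>) \<le> k) = (\<lambda>\<omega>. N \<le> k \<or> (\<exists>i\<in>{i. i \<le> k \<and> i < N}. Q i \<omega>))"
    by (rule ext) (rule least_le_iff)
  have some: "Measurable.pred ?F (\<lambda>\<omega>. \<exists>i\<in>{i. i \<le> k \<and> i < N}. Q i \<omega>)"
    using assms by (intro pred_intros_finite) (auto intro!: pred_natural_filtration_mono[OF assms(1)] ennreal_leI mult_right_mono)
  show ?thesis
  proof (cases "N \<le> k")
    case True
    then have "(\<lambda>\<omega>. N \<le> k \<or> (\<exists>i\<in>{i. i \<le> k \<and> i < N}. Q i \<omega>)) = (\<lambda>\<omega>. True)"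
      by blast
    then show ?thesis
      unfolding eq by (simp only:) (rule measurable_const, simp)
  next
    case False
    then have "(\<lambda>\<omega>. N \<le> k \<or> (\<exists>i\<in>{i. i \<le> k \<and> i < N}. Q i \<omega>)) = (\<lambda>\<omega>. \<exists>i\<in>{i. i \<le> k \<and> i < N}. Q i \<omega>)"
      by blast
    then show ?thesis
      unfolding eq using some by (simp only:)
  qed
qed

section \<open>The Markov property over one grid step\<close>

context brownian_motion
begin

lemma subalgebra_natural_filtration:
  "sets (natural_filtration (space M) Y t) \<subseteq> sets M"
  unfolding sets_natural_filtration
  by (rule sets.sigma_sets_subset) (auto intro: measurable_sets[OF measurable_Y])

lemma pred_natural_filtration:
  "Measurable.pred (natural_filtration (space M) Y t) Q \<Longrightarrow> Measurable.pred M Q"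
  using subalgebra_natural_filtration[of t] by (auto simp: pred_def)

lemma distr_increment:
  assumes "0 \<le> u" "0 < h"
  shows "distr M borel (\<lambda>\<omega>. Y (u + h) \<omega> - Y u \<omega>) = gauss h"
proof -
  have "distr M lborel (\<lambda>\<omega>. Y (u + h) \<omega> - Y u \<omega>) = gauss h"
    using normal_increments[of u "u + h"] assms by (simp add: distributed_def gauss_def)
  moreover have "distr M lborel (\<lambda>\<omega>. Y (u + h) \<omega> - Y u \<omega>) = distr M borel (\<lambda>\<omega>. Y (u + h) \<omega> - Y u \<omega>)"
    by (rule distr_cong) simp_all
  ultimately show ?thesis
    by simp
qed

text \<open>Almost surely \<open>Y u\<close> is \<open>y\<close> plus the increment from time 0,
  whose law is Gaussian or, for \<open>u = 0\<close>, degenerate.\<close>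

lemma integrable_Y:
  assumes "quadratic_growth g" "0 \<le> u"
  shows "integrable M (\<lambda>\<omega>. g (Y u \<omega>))"
proof -
  have [measurable]: "g \<in> borel_measurable borel" "Y u \<in> borel_measurable M" "Y 0 \<in> borel_measurable M"
    using assms measurable_Y quadratic_growth_measurable by auto
  have "AE \<omega> in M. g (y + (Y u \<omega> - Y 0 \<omega>)) = g (Y u \<omega>)"
    using start by eventually_elim simp
  moreover have "integrable M (\<lambda>\<omega>. g (y + (Y u \<omega> - Y 0 \<omega>)))"
  proof (cases "u = 0")
    case False
    then have "distr M borel (\<lambda>\<omega>. Y u \<omega> - Y 0 \<omega>) = gauss u"
      using distr_increment[of 0 u] assms by simp
    then have "integrable (distr M borel (\<lambda>\<omega>. Y u \<omega> - Y 0 \<omega>)) (\<lambda>z. g (y + z))"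
      using quadratic_growth_integrable[OF assms(1), of u y] assms False by simp
    then show ?thesis
      by (subst (asm) integrable_distr_eq) auto
  qed simp
  ultimately show ?thesis
    by (rule integrable_cong_AE_imp[rotated 2]) measurable
qed

lemma expectation_start:
  assumes [measurable]: "g \<in> borel_measurable borel"
  shows "(\<integral>\<omega>. g (Y 0 \<omega>) \<partial>M) = (g y :: real)"
proof -
  have [measurable]: "Y 0 \<in> borel_measurable M"
    using measurable_Y by simp
  have "(\<integral>\<omega>. g (Y 0 \<omega>) \<partial>M) = (\<integral>\<omega>. g y \<partial>M)"
    by (rule integral_cong_AE) (use start in \<open>auto elim!: eventually_mono\<close>)
  then show ?thesis
    by (simp add: prob_space)
qed

text \<open>The Markov property tested on a past event. The pair of \<open>indicator A\<close> and
  \<open>Y u\<close> is known at time \<open>u\<close>, hence independent of the next increment; the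
  joint law is a product and Fubini's theorem integrates out the increment.\<close>

lemma expectation_step:
  assumes "0 \<le> u" "0 < h" "quadratic_growth g"
    and A: "A \<in> sets (natural_filtration (space M) Y (ennreal u))"
  shows "(\<integral>\<omega>. indicator A \<omega> * g (Y (u + h) \<omega>) \<partial>M) = (\<integral>\<omega>. indicator A \<omega> * heat h g (Y u \<omega>) \<partial>M)"
proof -
  let ?F = "natural_filtration (space M) Y (ennreal u)"
  define X where "X \<omega> = (indicator A \<omega> :: real, Y u \<omega>)" for \<omega>
  define Z where "Z \<omega> = Y (u + h) \<omega> - Y u \<omega>" for \<omega>
  define \<phi> where "\<phi> p = fst (fst p) * g (snd (fst p) + snd p)" for p :: "(real \<times> real) \<times> real"
  have [measurable]: "g \<in> borel_measurable borel"
    using assms(3) by (rule quadratic_growth_measurable)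
  have [measurable]: "Y u \<in> borel_measurable M" "Y (u + h) \<in> borel_measurable M"
    using measurable_Y assms by auto
  have AM [measurable]: "A \<in> sets M"
    using A subalgebra_natural_filtration by blast
  have XF: "X \<in> ?F \<rightarrow>\<^sub>M borel \<Otimes>\<^sub>M borel"
    unfolding X_def using A assms(1)
    by (intro measurable_Pair borel_measurable_indicator measurable_natural_filtration) auto
  have X [measurable]: "X \<in> M \<rightarrow>\<^sub>M borel \<Otimes>\<^sub>M borel"
    unfolding X_def by measurable
  have Z [measurable]: "Z \<in> borel_measurable M"
    unfolding Z_def by measurable
  have \<phi> [measurable]: "\<phi> \<in> borel_measurable ((borel \<Otimes>\<^sub>M borel) \<Otimes>\<^sub>M borel)"
    unfolding \<phi>_def by measurable
  interpret X: prob_space "distr M (borel \<Otimes>\<^sub>M borel) X"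
    by (rule prob_space_distr) simp
  interpret Z: prob_space "gauss h"
    using assms(2) by (rule prob_space_gauss)
  interpret XZ: pair_prob_space "distr M (borel \<Otimes>\<^sub>M borel) X" "gauss h" ..
  have distr_Z: "distr M borel Z = gauss h"
    using distr_increment[OF assms(1,2)] by (simp add: Z_def [abs_def])
  have indep: "indep_set (sets ?F) {Z -` B \<inter> space M | B. B \<in> sets borel}"
    unfolding Z_def using assms by (intro indep_increments) auto
  \<comment> \<open>Equality on measurable rectangles suffices, and there it is the independence
    assumption.\<close>
  have joint: "distr M (borel \<Otimes>\<^sub>M borel) X \<Otimes>\<^sub>M gauss h =
      distr M ((borel \<Otimes>\<^sub>M borel) \<Otimes>\<^sub>M borel) (\<lambda>\<omega>. (X \<omega>, Z \<omega>))"
  proof (rule pair_measure_eqI)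
    show "sets (distr M (borel \<Otimes>\<^sub>M borel) X \<Otimes>\<^sub>M gauss h) =
        sets (distr M ((borel \<Otimes>\<^sub>M borel) \<Otimes>\<^sub>M borel) (\<lambda>\<omega>. (X \<omega>, Z \<omega>)))"
      by (simp cong: sets_pair_measure_cong)
    fix S B assume "S \<in> sets (distr M (borel \<Otimes>\<^sub>M borel) X)" "B \<in> sets (gauss h)"
    then have SB: "S \<in> sets (borel \<Otimes>\<^sub>M borel)" "B \<in> sets borel"
      by auto
    have "X -` S \<inter> space M \<in> sets ?F"
      using measurable_sets[OF XF SB(1)] by simp
    then have "prob ((X -` S \<inter> space M) \<inter> (Z -` B \<inter> space M)) = prob (X -` S \<inter> space M) * prob (Z -` B \<inter> space M)"
      using indep SB(2) unfolding indep_sets2_eq by blast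
    then have "emeasure M ((X -` S \<inter> space M) \<inter> (Z -` B \<inter> space M)) =
        emeasure M (X -` S \<inter> space M) * emeasure M (Z -` B \<inter> space M)"
      by (simp add: emeasure_eq_measure ennreal_mult)
    moreover have "(\<lambda>\<omega>. (X \<omega>, Z \<omega>)) -` (S \<times> B) \<inter> space M = (X -` S \<inter> space M) \<inter> (Z -` B \<inter> space M)"
      by auto
    ultimately show "emeasure (distr M (borel \<Otimes>\<^sub>M borel) X) S * emeasure (gauss h) B =
        emeasure (distr M ((borel \<Otimes>\<^sub>M borel) \<Otimes>\<^sub>M borel) (\<lambda>\<omega>. (X \<omega>, Z \<omega>))) (S \<times> B)"
      unfolding distr_Z[symmetric] using SB by (simp add: emeasure_distr)
  qed unfold_locales
  have \<phi>XZ: "\<phi> (X \<omega>, Z \<omega>) = indicator A \<omega> * g (Y (u + h) \<omega>)" for \<omega>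
    by (simp add: \<phi>_def X_def Z_def)
  have "integrable M (\<lambda>\<omega>. indicator A \<omega> * g (Y (u + h) \<omega>))"
    using integrable_Y[OF assms(3), of "u + h"] assms(1,2) AM integrable_mult_indicator[of A M "\<lambda>\<omega>. g (Y (u + h) \<omega>)"] by auto
  then have "integrable (distr M ((borel \<Otimes>\<^sub>M borel) \<Otimes>\<^sub>M borel) (\<lambda>\<omega>. (X \<omega>, Z \<omega>))) \<phi>"
    by (subst integrable_distr_eq) (simp_all add: \<phi>XZ)
  then have int: "integrable (distr M (borel \<Otimes>\<^sub>M borel) X \<Otimes>\<^sub>M gauss h) \<phi>"
    by (simp add: joint)
  have "(\<integral>\<omega>. indicator A \<omega> * g (Y (u + h) \<omega>) \<partial>M) =
      integral\<^sup>L (distr M ((borel \<Otimes>\<^sub>M borel) \<Otimes>\<^sub>M borel) (\<lambda>\<omega>. (X \<omega>, Z \<omega>))) \<phi>"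
    by (subst integral_distr) (simp_all add: \<phi>XZ)
  also have "\<dots> = (\<integral>p. (\<integral>z. \<phi> (p, z) \<partial>gauss h) \<partial>distr M (borel \<Otimes>\<^sub>M borel) X)"
    unfolding joint[symmetric] by (rule XZ.integral_fst'[OF int, symmetric])
  also have "\<dots> = (\<integral>\<omega>. (\<integral>z. \<phi> (X \<omega>, z) \<partial>gauss h) \<partial>M)"
    by (rule integral_distr) measurable
  also have "\<dots> = (\<integral>\<omega>. indicator A \<omega> * heat h g (Y u \<omega>) \<partial>M)"
    by (simp add: \<phi>_def X_def heat_def)
  finally show ?thesis .
qed

end

section \<open>Limits of expectations under a second moment bound\<close>

text \<open>
  Fatou's lemma applied to \<open>x + \<delta> * x\<^sup>2 + 1 / (4 * \<delta>) \<ge> 0\<close>, with \<open>\<delta> \<longrightarrow> 0\<close>.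
\<close>

lemma (in prob_space) expectation_limit_le:
  fixes X :: "nat \<Rightarrow> 'a \<Rightarrow> real"
  assumes lim: "\<And>\<omega>. \<omega> \<in> space M \<Longrightarrow> (\<lambda>n. X n \<omega>) \<longlonglongrightarrow> Z \<omega>"
    and [measurable]: "\<And>n. X n \<in> borel_measurable M"
    and square: "\<And>n. integrable M (\<lambda>\<omega>. (X n \<omega>)\<^sup>2)"
    and square_le: "\<And>n. (\<integral>\<omega>. (X n \<omega>)\<^sup>2 \<partial>M) \<le> K"
    and le: "\<And>n. (\<integral>\<omega>. X n \<omega> \<partial>M) \<le> B + \<epsilon> n"
    and \<epsilon>: "\<epsilon> \<longlonglongrightarrow> 0"
  shows "(\<integral>\<omega>. Z \<omega> \<partial>M) \<le> B"
proof -
  have K: "0 \<le> K"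
    by (rule order_trans[OF Bochner_Integration.integral_nonneg square_le[of 0]]) simp
  have Z [measurable]: "Z \<in> borel_measurable M"
    by (rule borel_measurable_LIMSEQ_real[OF lim]) simp_all
  have fatou: "(\<integral>\<^sup>+\<omega>. ennreal (\<phi> (Z \<omega>)) \<partial>M) \<le> ennreal D"
    if "continuous_on UNIV \<phi>" and "\<And>x. 0 \<le> \<phi> x" and "\<And>n. integrable M (\<lambda>\<omega>. \<phi> (X n \<omega>))"
      and "\<forall>\<^sub>F n in sequentially. (\<integral>\<omega>. \<phi> (X n \<omega>) \<partial>M) \<le> D" for \<phi> :: "real \<Rightarrow> real" and D
  proof -
    have [measurable]: "\<phi> \<in> borel_measurable borel"
      using that(1) by (rule borel_measurable_continuous_onI)
    have "(\<integral>\<^sup>+\<omega>. ennreal (\<phi> (Z \<omega>)) \<partial>M) = (\<integral>\<^sup>+\<omega>. liminf (\<lambda>n. ennreal (\<phi> (X n \<omega>))) \<partial>M)"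
    proof (rule nn_integral_cong)
      fix \<omega> assume "\<omega> \<in> space M"
      then have "(\<lambda>n. \<phi> (X n \<omega>)) \<longlonglongrightarrow> \<phi> (Z \<omega>)"
        using continuous_on_tendsto_compose[OF that(1) lim] by simp
      then have "(\<lambda>n. ennreal (\<phi> (X n \<omega>))) \<longlonglongrightarrow> ennreal (\<phi> (Z \<omega>))"
        by (rule tendsto_ennrealI)
      then show "ennreal (\<phi> (Z \<omega>)) = liminf (\<lambda>n. ennreal (\<phi> (X n \<omega>)))"
        by (simp add: lim_imp_Liminf)
    qed
    also have "\<dots> \<le> liminf (\<lambda>n. \<integral>\<^sup>+\<omega>. ennreal (\<phi> (X n \<omega>)) \<partial>M)"
      by (rule nn_integral_liminf) measurable
    also have "\<dots> = liminf (\<lambda>n. ennreal (\<integral>\<omega>. \<phi> (X n \<omega>) \<partial>M))"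
      using that(2,3) by (simp add: nn_integral_eq_integral)
    also have "\<dots> \<le> ennreal D"
      using that(4) by (intro Liminf_le) (auto elim!: eventually_mono intro: ennreal_leI)
    finally show ?thesis .
  qed
  \<comment> \<open>Fatou for squares comes first: it makes \<open>Z\<close> integrable, so that its
    Bochner integral is not a default value.\<close>
  have "(\<integral>\<^sup>+\<omega>. ennreal ((Z \<omega>)\<^sup>2) \<partial>M) \<le> ennreal K"
    using square square_le by (intro fatou continuous_intros) auto
  also have "\<dots> < \<infinity>"
    by simp
  finally have Z2: "integrable M (\<lambda>\<omega>. (Z \<omega>)\<^sup>2)"
    by (intro integrableI_bounded) simp_all
  then have Z1: "integrable M Z"
    by (rule square_integrable_imp_integrable[rotated]) simp
  have X1: "integrable M (X n)" for n
    using square by (rule square_integrable_imp_integrable[rotated]) simp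
  show ?thesis
  proof (rule field_le_epsilon)
    fix e :: real assume e: "0 < e"
    \<comment> \<open>Makes the quadratic penalty at most \<open>e / 2\<close>; the other half of
      \<open>e\<close> absorbs \<open>\<epsilon> n\<close> for large \<open>n\<close>.\<close>
    define \<delta> where "\<delta> = e / (2 * (K + 1))"
    have \<delta>: "0 < \<delta>"
      using e K by (simp add: \<delta>_def)
    have "\<delta> * K \<le> \<delta> * (K + 1)"
      using \<delta> by simp
    also have "\<dots> = e / 2"
      using K by (simp add: \<delta>_def field_simps)
    finally have \<delta>K: "\<delta> * K \<le> e / 2" .
    define \<phi> where "\<phi> x = x + \<delta> * x\<^sup>2 + 1 / (4 * \<delta>)" for x
    define D where "D = B + e + 1 / (4 * \<delta>)"
    have \<phi>_nonneg: "0 \<le> \<phi> x" for x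
    proof -
      have "\<phi> x = \<delta> * (x + 1 / (2 * \<delta>))\<^sup>2"
        using \<delta> by (simp add: \<phi>_def power2_eq_square field_simps)
      then show ?thesis
        using \<delta> by simp
    qed
    have \<phi>X: "integrable M (\<lambda>\<omega>. \<phi> (X n \<omega>))" for n
      unfolding \<phi>_def using X1 square by simp
    have \<phi>Z: "integrable M (\<lambda>\<omega>. \<phi> (Z \<omega>))"
      unfolding \<phi>_def using Z1 Z2 by simp
    have "\<forall>\<^sub>F n in sequentially. \<epsilon> n < e / 2"
      using order_tendstoD(2)[OF \<epsilon>, of "e / 2"] e by simp
    then have "\<forall>\<^sub>F n in sequentially. (\<integral>\<omega>. \<phi> (X n \<omega>) \<partial>M) \<le> D"
    proof eventually_elim
      case (elim n)
      have "(\<integral>\<omega>. \<phi> (X n \<omega>) \<partial>M) = (\<integral>\<omega>. X n \<omega> \<partial>M) + \<delta> * (\<integral>\<omega>. (X n \<omega>)\<^sup>2 \<partial>M) + 1 / (4 * \<delta>)"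
        unfolding \<phi>_def using X1 square prob_space by simp
      moreover have "\<delta> * (\<integral>\<omega>. (X n \<omega>)\<^sup>2 \<partial>M) \<le> \<delta> * K"
        using square_le \<delta> by (intro mult_left_mono) auto
      ultimately show ?case
        using le[of n] elim \<delta>K by (simp add: D_def)
    qed
    then have "(\<integral>\<^sup>+\<omega>. ennreal (\<phi> (Z \<omega>)) \<partial>M) \<le> ennreal D"
      using \<phi>_nonneg \<phi>X by (intro fatou) (auto simp: \<phi>_def intro!: continuous_intros)
    then have "ennreal (\<integral>\<omega>. \<phi> (Z \<omega>) \<partial>M) \<le> ennreal D"
      using nn_integral_eq_integral[OF \<phi>Z] \<phi>_nonneg by simp
    \<comment> \<open>Since \<open>ennreal\<close> sends negative reals to 0, the comparison returns
      to the reals only once \<open>D\<close> is known to be nonnegative.\<close>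
    moreover have "0 \<le> D"
    proof -
      obtain n where n: "(\<integral>\<omega>. \<phi> (X n \<omega>) \<partial>M) \<le> D"
        using \<open>\<forall>\<^sub>F n in sequentially. (\<integral>\<omega>. \<phi> (X n \<omega>) \<partial>M) \<le> D\<close> by (auto dest: eventually_happens)
      show ?thesis
        by (rule order_trans[OF Bochner_Integration.integral_nonneg n]) (rule \<phi>_nonneg)
    qed
    ultimately have "(\<integral>\<omega>. \<phi> (Z \<omega>) \<partial>M) \<le> D"
      by (simp add: ennreal_le_iff)
    moreover have "(\<integral>\<omega>. \<phi> (Z \<omega>) \<partial>M) = (\<integral>\<omega>. Z \<omega> \<partial>M) + \<delta> * (\<integral>\<omega>. (Z \<omega>)\<^sup>2 \<partial>M) + 1 / (4 * \<delta>)"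
      unfolding \<phi>_def using Z1 Z2 prob_space by simp
    moreover have "0 \<le> \<delta> * (\<integral>\<omega>. (Z \<omega>)\<^sup>2 \<partial>M)"
      using \<delta> by simp
    ultimately show "(\<integral>\<omega>. Z \<omega> \<partial>M) \<le> B + e"
      by (simp add: D_def)
  qed
qed

lemma integrable_indicator_mult:
  fixes g :: "'a \<Rightarrow> real"
  assumes "A \<in> sets M" "integrable M g"
  shows "integrable M (\<lambda>\<omega>. indicator A \<omega> * g \<omega>)"
  using integrable_mult_indicator[OF assms] by simp

section \<open>Optional stopping on the grid\<close>

context brownian_motion
begin

text \<open>
  The gain \<open>g\<close> collected at \<open>\<kappa>\<close> if \<open>\<kappa>\<close> comes before step \<open>j\<close>, and otherwise the continuation value
  \<open>U j\<close>: a supermartingale in \<open>j\<close> interpolating between \<open>U 0 y\<close> and the gain of \<open>\<kappa>\<close>.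
\<close>

definition stopped ::
  "real \<Rightarrow> ('a \<Rightarrow> nat) \<Rightarrow> (nat \<Rightarrow> real \<Rightarrow> real) \<Rightarrow> (nat \<Rightarrow> real \<Rightarrow> real) \<Rightarrow> nat \<Rightarrow> 'a \<Rightarrow> real" where
  "stopped h \<kappa> g U j \<omega> =
     (if \<kappa> \<omega> < j then g (\<kappa> \<omega>) (Y (real (\<kappa> \<omega>) * h) \<omega>) else U j (Y (real j * h) \<omega>))"

lemma integrable_stopped_before:
  assumes "0 < h"
    and \<kappa>: "\<And>k. Measurable.pred (natural_filtration (space M) Y (ennreal (real k * h))) (\<lambda>\<omega>. \<kappa> \<omega> \<le> k)"
    and g: "\<And>k. k < j \<Longrightarrow> quadratic_growth (g k)"
  shows "integrable M (\<lambda>\<omega>. if \<kappa> \<omega> < j then g (\<kappa> \<omega>) (Y (real (\<kappa> \<omega>) * h) \<omega>) else 0)"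
proof -
  have [measurable]: "Measurable.pred M (\<lambda>\<omega>. \<kappa> \<omega> \<le> k)" for k
    using \<kappa> by (rule pred_natural_filtration)
  \<comment> \<open>The guard is for \<open>k = 0\<close>, where truncated subtraction gives
    \<open>k - 1 = 0\<close>.\<close>
  have eq: "(\<lambda>\<omega>. \<kappa> \<omega> = k) = (\<lambda>\<omega>. \<kappa> \<omega> \<le> k \<and> (k \<noteq> 0 \<longrightarrow> \<not> \<kappa> \<omega> \<le> k - 1))" for k
    by (rule ext) auto
  have [measurable]: "Measurable.pred M (\<lambda>\<omega>. \<kappa> \<omega> = k)" for k
    unfolding eq by measurable
  have "(if \<kappa> \<omega> < j then g (\<kappa> \<omega>) (Y (real (\<kappa> \<omega>) * h) \<omega>) else 0) =
      (\<Sum>k<j. indicator {\<omega>\<in>space M. \<kappa> \<omega> = k} \<omega> * g k (Y (real k * h) \<omega>))" if "\<omega> \<in> space M" for \<omega>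
  proof -
    have "(\<Sum>k<j. indicator {\<omega>\<in>space M. \<kappa> \<omega> = k} \<omega> * g k (Y (real k * h) \<omega>)) =
        (\<Sum>k<j. if k = \<kappa> \<omega> then g k (Y (real k * h) \<omega>) else 0)"
      by (rule sum.cong) (use that in \<open>auto simp: indicator_def\<close>)
    then show ?thesis
      by simp
  qed
  moreover have "integrable M (\<lambda>\<omega>. \<Sum>k<j. indicator {\<omega>\<in>space M. \<kappa> \<omega> = k} \<omega> * g k (Y (real k * h) \<omega>))"
    using g assms(1) by (intro Bochner_Integration.integrable_sum integrable_indicator_mult integrable_Y) simp_all
  ultimately show ?thesis
    by (subst Bochner_Integration.integrable_cong[OF refl]) auto
qed

lemma integrable_after:
  assumes "0 < h"
    and \<kappa>: "\<And>k. Measurable.pred (natural_filtration (space M) Y (ennreal (real k * h))) (\<lambda>\<omega>. \<kappa> \<omega> \<le> k)"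
    and "quadratic_growth u" "0 \<le> t"
  shows "integrable M (\<lambda>\<omega>. if \<kappa> \<omega> < j then 0 else u (Y t \<omega>))"
proof -
  have [measurable]: "Measurable.pred M (\<lambda>\<omega>. \<kappa> \<omega> \<le> k)" for k
    using \<kappa> by (rule pred_natural_filtration)
  have eq: "(\<lambda>\<omega>. \<kappa> \<omega> < j) = (\<lambda>\<omega>. j \<noteq> 0 \<and> \<kappa> \<omega> \<le> j - 1)"
    by (rule ext) auto
  have [measurable]: "Measurable.pred M (\<lambda>\<omega>. \<kappa> \<omega> < j)"
    unfolding eq by measurable
  have "integrable M (\<lambda>\<omega>. indicator {\<omega>\<in>space M. \<not> \<kappa> \<omega> < j} \<omega> * u (Y t \<omega>))"
    by (intro integrable_indicator_mult integrable_Y assms(3,4)) measurable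
  then show ?thesis
    by (rule Bochner_Integration.integrable_cong[OF refl, THEN iffD1, rotated]) (auto simp: indicator_def)
qed

lemma integrable_stopped:
  assumes "0 < h"
    and "\<And>k. Measurable.pred (natural_filtration (space M) Y (ennreal (real k * h))) (\<lambda>\<omega>. \<kappa> \<omega> \<le> k)"
    and "\<And>k. k < j \<Longrightarrow> quadratic_growth (g k)" "quadratic_growth (U j)"
  shows "integrable M (stopped h \<kappa> g U j)"
proof -
  have "stopped h \<kappa> g U j = (\<lambda>\<omega>. (if \<kappa> \<omega> < j then g (\<kappa> \<omega>) (Y (real (\<kappa> \<omega>) * h) \<omega>) else 0) +
      (if \<kappa> \<omega> < j then 0 else U j (Y (real j * h) \<omega>)))"
    by (simp add: fun_eq_iff stopped_def)
  moreover have "integrable M \<dots>"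
    using assms(1) by (intro Bochner_Integration.integrable_add integrable_stopped_before[OF assms(1-3)] integrable_after[OF assms(1,2,4)]) simp_all
  ultimately show ?thesis
    by (simp only:)
qed

text \<open>The event that \<open>\<kappa>\<close> exceeds \<open>j\<close> is known at time
  \<open>j * h\<close>, so \<open>expectation_step\<close> replaces \<open>U (Suc j)\<close> by its
  average there. Compared with \<open>stopped h \<kappa> g U j\<close>, the integrand now has
  \<open>g j\<close> where \<open>\<kappa> = j\<close> and an average where
  \<open>\<kappa> > j\<close>.\<close>

lemma expectation_stopped_Suc:
  assumes "0 < h"
    and \<kappa>: "\<And>k. Measurable.pred (natural_filtration (space M) Y (ennreal (real k * h))) (\<lambda>\<omega>. \<kappa> \<omega> \<le> k)"
    and g: "\<And>k. k \<le> j \<Longrightarrow> quadratic_growth (g k)" and U: "quadratic_growth (U (Suc j))"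
  shows "(\<integral>\<omega>. stopped h \<kappa> g U (Suc j) \<omega> \<partial>M) =
    (\<integral>\<omega>. (if \<kappa> \<omega> \<le> j then g (\<kappa> \<omega>) (Y (real (\<kappa> \<omega>) * h) \<omega>) else heat h (U (Suc j)) (Y (real j * h) \<omega>)) \<partial>M)"
    and "integrable M (\<lambda>\<omega>. if \<kappa> \<omega> \<le> j then g (\<kappa> \<omega>) (Y (real (\<kappa> \<omega>) * h) \<omega>) else heat h (U (Suc j)) (Y (real j * h) \<omega>))"
proof -
  let ?F = "natural_filtration (space M) Y (ennreal (real j * h))"
  let ?R = "\<lambda>\<omega>. if \<kappa> \<omega> < Suc j then g (\<kappa> \<omega>) (Y (real (\<kappa> \<omega>) * h) \<omega>) else 0"
  define A where "A = {\<omega>\<in>space M. \<not> \<kappa> \<omega> \<le> j}"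
  have j: "0 \<le> real j * h" "real (Suc j) * h = real j * h + h" "0 \<le> real (Suc j) * h"
    using assms(1) by (simp_all add: algebra_simps)
  have A: "A \<in> sets ?F"
  proof -
    have "A = space ?F - {\<omega>\<in>space ?F. \<kappa> \<omega> \<le> j}"
      by (auto simp: A_def)
    then show ?thesis
      using \<kappa>[of j] sets.compl_sets[of "{\<omega>\<in>space ?F. \<kappa> \<omega> \<le> j}" ?F] unfolding pred_def by simp
  qed
  have R: "integrable M ?R"
    using assms by (intro integrable_stopped_before) auto
  have T: "quadratic_growth (heat h (U (Suc j)))"
    using U assms(1) by (rule quadratic_growth_heat)
  have int: "integrable M (\<lambda>\<omega>. if \<kappa> \<omega> < Suc j then 0 else u (Y t \<omega>))" if "quadratic_growth u" "0 \<le> t" for u t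
    using assms(1,2) that by (rule integrable_after)
  have ind: "(if \<kappa> \<omega> < Suc j then 0 else u (Y t \<omega>)) = indicator A \<omega> * u (Y t \<omega>)" if "\<omega> \<in> space M" for u :: "real \<Rightarrow> real" and t \<omega>
    using that by (simp add: A_def indicator_def less_Suc_eq_le)
  have "(\<integral>\<omega>. stopped h \<kappa> g U (Suc j) \<omega> \<partial>M) =
      (\<integral>\<omega>. ?R \<omega> + (if \<kappa> \<omega> < Suc j then 0 else U (Suc j) (Y (real (Suc j) * h) \<omega>)) \<partial>M)"
    by (rule Bochner_Integration.integral_cong) (simp_all add: stopped_def)
  also have "\<dots> = (\<integral>\<omega>. ?R \<omega> \<partial>M) + (\<integral>\<omega>. (if \<kappa> \<omega> < Suc j then 0 else U (Suc j) (Y (real (Suc j) * h) \<omega>)) \<partial>M)"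
    by (rule Bochner_Integration.integral_add[OF R int[OF U j(3)]])
  also have "(\<integral>\<omega>. (if \<kappa> \<omega> < Suc j then 0 else U (Suc j) (Y (real (Suc j) * h) \<omega>)) \<partial>M) =
      (\<integral>\<omega>. indicator A \<omega> * U (Suc j) (Y (real j * h + h) \<omega>) \<partial>M)"
    unfolding j(2) by (rule Bochner_Integration.integral_cong) (simp_all only: ind)
  also have "\<dots> = (\<integral>\<omega>. indicator A \<omega> * heat h (U (Suc j)) (Y (real j * h) \<omega>) \<partial>M)"
    by (rule expectation_step[OF j(1) assms(1) U A])
  also have "\<dots> = (\<integral>\<omega>. (if \<kappa> \<omega> < Suc j then 0 else heat h (U (Suc j)) (Y (real j * h) \<omega>)) \<partial>M)"
    by (rule Bochner_Integration.integral_cong) (simp_all only: ind)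
  also have "(\<integral>\<omega>. ?R \<omega> \<partial>M) + \<dots> = (\<integral>\<omega>. ?R \<omega> + (if \<kappa> \<omega> < Suc j then 0 else heat h (U (Suc j)) (Y (real j * h) \<omega>)) \<partial>M)"
    by (rule Bochner_Integration.integral_add[symmetric, OF R int[OF T j(1)]])
  also have "(\<lambda>\<omega>. ?R \<omega> + (if \<kappa> \<omega> < Suc j then 0 else heat h (U (Suc j)) (Y (real j * h) \<omega>))) =
      (\<lambda>\<omega>. if \<kappa> \<omega> \<le> j then g (\<kappa> \<omega>) (Y (real (\<kappa> \<omega>) * h) \<omega>) else heat h (U (Suc j)) (Y (real j * h) \<omega>))"
    by (simp add: fun_eq_iff less_Suc_eq_le)
  finally show "(\<integral>\<omega>. stopped h \<kappa> g U (Suc j) \<omega> \<partial>M) =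
    (\<integral>\<omega>. (if \<kappa> \<omega> \<le> j then g (\<kappa> \<omega>) (Y (real (\<kappa> \<omega>) * h) \<omega>) else heat h (U (Suc j)) (Y (real j * h) \<omega>)) \<partial>M)" .
  have "integrable M (\<lambda>\<omega>. ?R \<omega> + (if \<kappa> \<omega> < Suc j then 0 else heat h (U (Suc j)) (Y (real j * h) \<omega>)))"
    by (rule Bochner_Integration.integrable_add[OF R int[OF T j(1)]])
  moreover have "(\<lambda>\<omega>. ?R \<omega> + (if \<kappa> \<omega> < Suc j then 0 else heat h (U (Suc j)) (Y (real j * h) \<omega>))) =
      (\<lambda>\<omega>. if \<kappa> \<omega> \<le> j then g (\<kappa> \<omega>) (Y (real (\<kappa> \<omega>) * h) \<omega>) else heat h (U (Suc j)) (Y (real j * h) \<omega>))"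
    by (simp add: fun_eq_iff less_Suc_eq_le)
  ultimately show "integrable M (\<lambda>\<omega>. if \<kappa> \<omega> \<le> j then g (\<kappa> \<omega>) (Y (real (\<kappa> \<omega>) * h) \<omega>) else heat h (U (Suc j)) (Y (real j * h) \<omega>))"
    by simp
qed

lemma expectation_stopped_0:
  assumes "quadratic_growth (U 0)"
  shows "(\<integral>\<omega>. stopped h \<kappa> g U 0 \<omega> \<partial>M) = U 0 y"
  using expectation_start[OF quadratic_growth_measurable[OF assms]] by (simp add: stopped_def)

lemma integrable_at_stopping:
  assumes "0 < h"
    and "\<And>k. Measurable.pred (natural_filtration (space M) Y (ennreal (real k * h))) (\<lambda>\<omega>. \<kappa> \<omega> \<le> k)"
    and "\<And>k. k \<le> N \<Longrightarrow> quadratic_growth (g k)"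
    and N: "\<And>\<omega>. \<kappa> \<omega> \<le> N"
  shows "integrable M (\<lambda>\<omega>. g (\<kappa> \<omega>) (Y (real (\<kappa> \<omega>) * h) \<omega>))"
  using integrable_stopped_before[of h \<kappa> "Suc N" g] assms by (simp add: less_Suc_eq_le)

text \<open>Optional stopping for supermartingales: passing from \<open>j\<close> to
  \<open>Suc j\<close> loses by \<open>dominates\<close> where \<open>\<kappa> = j\<close> and by
  \<open>decrease\<close> where \<open>\<kappa> > j\<close>.\<close>

lemma expectation_stopped_le:
  assumes "0 < h"
    and \<kappa>: "\<And>k. Measurable.pred (natural_filtration (space M) Y (ennreal (real k * h))) (\<lambda>\<omega>. \<kappa> \<omega> \<le> k)"
    and N: "\<And>\<omega>. \<kappa> \<omega> \<le> N"
    and g: "\<And>k. k \<le> N \<Longrightarrow> quadratic_growth (g k)" and U: "\<And>k. k \<le> N \<Longrightarrow> quadratic_growth (U k)"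
    and dominates: "\<And>k x. k \<le> N \<Longrightarrow> g k x \<le> U k x"
    and decrease: "\<And>k x. k < N \<Longrightarrow> heat h (U (Suc k)) x \<le> U k x"
  shows "(\<integral>\<omega>. g (\<kappa> \<omega>) (Y (real (\<kappa> \<omega>) * h) \<omega>) \<partial>M) \<le> U 0 y"
proof -
  have "(\<integral>\<omega>. stopped h \<kappa> g U j \<omega> \<partial>M) \<le> U 0 y" if "j \<le> N" for j
    using that
  proof (induction j)
    case 0
    then show ?case
      using expectation_stopped_0 U by simp
  next
    case (Suc j)
    have "(\<integral>\<omega>. stopped h \<kappa> g U (Suc j) \<omega> \<partial>M) =
        (\<integral>\<omega>. (if \<kappa> \<omega> \<le> j then g (\<kappa> \<omega>) (Y (real (\<kappa> \<omega>) * h) \<omega>) else heat h (U (Suc j)) (Y (real j * h) \<omega>)) \<partial>M)"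
      using Suc.prems g U by (intro expectation_stopped_Suc[OF assms(1) \<kappa>]) auto
    also have "\<dots> \<le> (\<integral>\<omega>. stopped h \<kappa> g U j \<omega> \<partial>M)"
    proof (rule integral_mono)
      show "integrable M (\<lambda>\<omega>. if \<kappa> \<omega> \<le> j then g (\<kappa> \<omega>) (Y (real (\<kappa> \<omega>) * h) \<omega>) else heat h (U (Suc j)) (Y (real j * h) \<omega>))"
        using Suc.prems g U by (intro expectation_stopped_Suc[OF assms(1) \<kappa>]) auto
      show "integrable M (stopped h \<kappa> g U j)"
        using Suc.prems g U by (intro integrable_stopped[OF assms(1) \<kappa>]) auto
      show "(if \<kappa> \<omega> \<le> j then g (\<kappa> \<omega>) (Y (real (\<kappa> \<omega>) * h) \<omega>) else heat h (U (Suc j)) (Y (real j * h) \<omega>)) \<le> stopped h \<kappa> g U j \<omega>" for \<omega>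
        using Suc.prems dominates decrease by (auto simp: stopped_def)
    qed
    finally show ?case
      using Suc by simp
  qed
  from this[of N] have "(\<integral>\<omega>. stopped h \<kappa> g U N \<omega> \<partial>M) \<le> U 0 y"
    by simp
  moreover have "(\<integral>\<omega>. g (\<kappa> \<omega>) (Y (real (\<kappa> \<omega>) * h) \<omega>) \<partial>M) \<le> (\<integral>\<omega>. stopped h \<kappa> g U N \<omega> \<partial>M)"
  proof (rule integral_mono)
    show "integrable M (\<lambda>\<omega>. g (\<kappa> \<omega>) (Y (real (\<kappa> \<omega>) * h) \<omega>))"
      using integrable_at_stopping[OF assms(1) \<kappa> g N] .
    show "integrable M (stopped h \<kappa> g U N)"
      using g U by (intro integrable_stopped[OF assms(1) \<kappa>]) auto
    show "g (\<kappa> \<omega>) (Y (real (\<kappa> \<omega>) * h) \<omega>) \<le> stopped h \<kappa> g U N \<omega>" for \<omega>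
      using dominates[of N] N[of \<omega>] by (cases "\<kappa> \<omega> = N") (auto simp: stopped_def)
  qed
  ultimately show ?thesis
    by simp
qed

text \<open>The martingale counterpart. The two equalities are required only along the paths up to
  \<open>\<kappa>\<close>, which is what an optimal rule provides.\<close>

lemma expectation_stopped_eq:
  assumes "0 < h"
    and \<kappa>: "\<And>k. Measurable.pred (natural_filtration (space M) Y (ennreal (real k * h))) (\<lambda>\<omega>. \<kappa> \<omega> \<le> k)"
    and N: "\<And>\<omega>. \<kappa> \<omega> \<le> N"
    and g: "\<And>k. k \<le> N \<Longrightarrow> quadratic_growth (g k)" and U: "\<And>k. k \<le> N \<Longrightarrow> quadratic_growth (U k)"
    and at_stop: "\<And>\<omega>. U (\<kappa> \<omega>) (Y (real (\<kappa> \<omega>) * h) \<omega>) = g (\<kappa> \<omega>) (Y (real (\<kappa> \<omega>) * h) \<omega>)"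
    and before: "\<And>k \<omega>. k < \<kappa> \<omega> \<Longrightarrow> heat h (U (Suc k)) (Y (real k * h) \<omega>) = U k (Y (real k * h) \<omega>)"
  shows "(\<integral>\<omega>. g (\<kappa> \<omega>) (Y (real (\<kappa> \<omega>) * h) \<omega>) \<partial>M) = U 0 y"
proof -
  have "(\<integral>\<omega>. stopped h \<kappa> g U j \<omega> \<partial>M) = U 0 y" if "j \<le> N" for j
    using that
  proof (induction j)
    case 0
    then show ?case
      using expectation_stopped_0 U by simp
  next
    case (Suc j)
    have "(\<integral>\<omega>. stopped h \<kappa> g U (Suc j) \<omega> \<partial>M) =
        (\<integral>\<omega>. (if \<kappa> \<omega> \<le> j then g (\<kappa> \<omega>) (Y (real (\<kappa> \<omega>) * h) \<omega>) else heat h (U (Suc j)) (Y (real j * h) \<omega>)) \<partial>M)"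
      using Suc.prems g U by (intro expectation_stopped_Suc[OF assms(1) \<kappa>]) auto
    also have "\<dots> = (\<integral>\<omega>. stopped h \<kappa> g U j \<omega> \<partial>M)"
    proof (rule Bochner_Integration.integral_cong[OF refl])
      show "(if \<kappa> \<omega> \<le> j then g (\<kappa> \<omega>) (Y (real (\<kappa> \<omega>) * h) \<omega>) else heat h (U (Suc j)) (Y (real j * h) \<omega>)) = stopped h \<kappa> g U j \<omega>" for \<omega>
        using at_stop[of \<omega>] before[of j \<omega>] by (auto simp: stopped_def)
    qed
    finally show ?case
      using Suc by simp
  qed
  from this[of N] have "(\<integral>\<omega>. stopped h \<kappa> g U N \<omega> \<partial>M) = U 0 y"
    by simp
  moreover have "stopped h \<kappa> g U N = (\<lambda>\<omega>. g (\<kappa> \<omega>) (Y (real (\<kappa> \<omega>) * h) \<omega>))"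
  proof
    fix \<omega>
    show "stopped h \<kappa> g U N \<omega> = g (\<kappa> \<omega>) (Y (real (\<kappa> \<omega>) * h) \<omega>)"
      using at_stop[of \<omega>] N[of \<omega>] by (cases "\<kappa> \<omega> = N") (auto simp: stopped_def)
  qed
  ultimately show ?thesis
    by simp
qed

end

section \<open>Passage to continuous time\<close>

text \<open>The difference \<open>t - f \<alpha> t\<close> stays bounded, so \<open>G\<close>
  approaches \<open>c\<close> at late times. This controls the error of being forced to stop at a
  distant horizon.\<close>

lemma abs_G_minus_limit_le:
  assumes "0 \<le> t"
  shows "\<bar>G \<alpha> c t x - c\<bar> \<le> (\<bar>c\<bar> * cosh \<alpha> + \<bar>x\<bar>) / (1 + t)"
proof -
  have ft: "0 < f \<alpha> t" "1 + t \<le> f \<alpha> t"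
    using f_pos f_ge_add_one assms by auto
  have "\<bar>t - f \<alpha> t\<bar> \<le> cosh \<alpha>"
    using f_le_add_cosh[OF assms, of \<alpha>] ft by simp
  then have "\<bar>c * (t - f \<alpha> t)\<bar> \<le> \<bar>c\<bar> * cosh \<alpha>"
    unfolding abs_mult by (rule mult_left_mono) simp
  then have "\<bar>c * (t - f \<alpha> t) + x\<bar> \<le> \<bar>c\<bar> * cosh \<alpha> + \<bar>x\<bar>"
    by linarith
  moreover have "G \<alpha> c t x - c = (c * (t - f \<alpha> t) + x) / f \<alpha> t"
    using ft by (simp add: G_def field_simps)
  ultimately show ?thesis
    using ft assms by (simp only: abs_divide) (intro frac_le; simp)
qed

text \<open>
  A superharmonic bound for \<open>G\<^sup>2\<close>, which makes the rounded gains uniformly integrable.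
\<close>

definition potential :: "real \<Rightarrow> real \<Rightarrow> real \<Rightarrow> real" where
  "potential \<alpha> t x = 1 / (f \<alpha> t)\<^sup>2 * (x + 0)\<^sup>2 + 1 / f \<alpha> t"

lemma quadratic_growth_potential: "quadratic_growth (potential \<alpha> t)"
  unfolding potential_def by (rule quadratic_growth_quadratic)

lemma potential_nonneg: "0 \<le> potential \<alpha> t x" if "0 \<le> t"
  using f_nonneg[OF that, of \<alpha>] by (simp add: potential_def)

text \<open>The variance contribution \<open>h / v\<^sup>2\<close> is at most the decrease
  \<open>1 / u - 1 / v\<close>, because \<open>f\<close> grows by at least \<open>h\<close> over the
  step.\<close>

lemma heat_potential_le:
  assumes "0 < h" "0 \<le> t"
  shows "heat h (potential \<alpha> (t + h)) x \<le> potential \<alpha> t x"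
proof -
  define u where "u = f \<alpha> t"
  define v where "v = f \<alpha> (t + h)"
  have uv: "0 < u" "h \<le> v - u"
    using f_pos[of t \<alpha>] f_increment[of t "t + h" \<alpha>] assms by (auto simp: u_def v_def)
  then have v: "0 < v" "u \<le> v"
    using assms by auto
  have "1 / v\<^sup>2 * h \<le> (v - u) / (u * v)"
    using uv v assms by (simp add: power2_eq_square) (intro frac_le mult_right_mono; simp)
  also have "\<dots> = 1 / u - 1 / v"
    using uv v by (simp add: field_simps)
  finally have "1 / v\<^sup>2 * h + 1 / v \<le> 1 / u"
    by simp
  moreover have "1 / v\<^sup>2 * x\<^sup>2 \<le> 1 / u\<^sup>2 * x\<^sup>2"
    using uv v by (intro mult_right_mono divide_left_mono power_mono) auto
  ultimately show ?thesis
    unfolding potential_def heat_square[OF assms(1)] u_def[symmetric] v_def[symmetric]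
    by (simp add: distrib_left)
qed

lemma G_square_le:
  assumes "0 \<le> t"
  shows "(G \<alpha> c t x)\<^sup>2 \<le> 2 * c\<^sup>2 + 2 * potential \<alpha> t x"
proof -
  have ft: "0 < f \<alpha> t" "t \<le> f \<alpha> t"
    using f_pos[OF assms, of \<alpha>] f_ge_add_one[OF assms, of \<alpha>] by auto
  have "(G \<alpha> c t x)\<^sup>2 = (c * (t / f \<alpha> t) + x / f \<alpha> t)\<^sup>2"
    by (simp add: G_def add_divide_distrib)
  also have "\<dots> \<le> 2 * (c * (t / f \<alpha> t))\<^sup>2 + 2 * (x / f \<alpha> t)\<^sup>2"
    by (rule square_add_le)
  also have "(c * (t / f \<alpha> t))\<^sup>2 \<le> c\<^sup>2 * 1"
    unfolding power_mult_distrib using ft assms by (intro mult_left_mono power_le_one) auto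
  also have "(x / f \<alpha> t)\<^sup>2 \<le> potential \<alpha> t x"
    using ft by (simp add: potential_def power_divide)
  finally show ?thesis
    by simp
qed

text \<open>Rounding up to a grid with last point \<open>N * h\<close>: by minimality the preceding
  grid point lies below the rounded time, so the overshoot is at most one step.\<close>

lemma Least_grid:
  fixes h :: real and \<tau> :: ennreal and N :: nat
  assumes "0 < h"
  defines "k \<equiv> (LEAST k. k = N \<or> \<tau> \<le> ennreal (real k * h))"
  shows "k \<le> N"
    and "\<not> \<tau> \<le> ennreal (real N * h) \<Longrightarrow> k = N"
    and "\<tau> = ennreal t \<Longrightarrow> 0 \<le> t \<Longrightarrow> t \<le> real N * h \<Longrightarrow> t \<le> real k * h \<and> real k * h \<le> t + h"
proof -
  have k: "k = N \<or> \<tau> \<le> ennreal (real k * h)"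
    unfolding k_def by (rule LeastI[of _ N]) simp
  show kN: "k \<le> N"
    unfolding k_def by (rule Least_le) simp
  show "k = N" if "\<not> \<tau> \<le> ennreal (real N * h)"
  proof (rule ccontr)
    assume "k \<noteq> N"
    then have "\<tau> \<le> ennreal (real k * h)"
      using k by simp
    also have "\<dots> \<le> ennreal (real N * h)"
      using kN assms(1) by (intro ennreal_leI mult_right_mono) auto
    finally show False
      using that by simp
  qed
  show "t \<le> real k * h \<and> real k * h \<le> t + h" if t: "\<tau> = ennreal t" "0 \<le> t" "t \<le> real N * h"
  proof
    show "t \<le> real k * h"
      using k t assms(1) by (auto simp: ennreal_le_iff)
    show "real k * h \<le> t + h"
    proof (cases k)
      case 0
      then show ?thesis
        using t assms(1) by simp
    next
      case (Suc j)
      then have "\<not> (j = N \<or> \<tau> \<le> ennreal (real j * h))"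
        unfolding k_def by (intro not_less_Least) simp
      then have "real j * h < t"
        using t assms(1) by (auto simp: ennreal_le_iff)
      then show ?thesis
        using Suc by (simp add: algebra_simps)
    qed
  qed
qed

section \<open>Rounding stopping times to the grid\<close>

context brownian_motion
begin

lemma expectation_square:
  assumes "0 < u"
  shows "(\<integral>\<omega>. (Y u \<omega>)\<^sup>2 \<partial>M) = y\<^sup>2 + u"
proof -
  let ?g = "\<lambda>x :: real. 1 * (x + 0)\<^sup>2 + 0"
  have space: "space M \<in> sets (natural_filtration (space M) Y (ennreal 0))"
    using sets.top[of "natural_filtration (space M) Y (ennreal 0)"] by simp
  have "(\<integral>\<omega>. (Y u \<omega>)\<^sup>2 \<partial>M) = (\<integral>\<omega>. indicator (space M) \<omega> * ?g (Y (0 + u) \<omega>) \<partial>M)"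
    by (rule Bochner_Integration.integral_cong) auto
  also have "\<dots> = (\<integral>\<omega>. indicator (space M) \<omega> * heat u ?g (Y 0 \<omega>) \<partial>M)"
    using assms by (intro expectation_step quadratic_growth_quadratic space) auto
  also have "\<dots> = (\<integral>\<omega>. (Y 0 \<omega>)\<^sup>2 + u \<partial>M)"
    unfolding heat_square[OF assms] by (rule Bochner_Integration.integral_cong) auto
  also have "\<dots> = y\<^sup>2 + u"
    by (rule expectation_start) measurable
  finally show ?thesis .
qed

lemma integrable_Y_square: "0 \<le> u \<Longrightarrow> integrable M (\<lambda>\<omega>. (Y u \<omega>)\<^sup>2)"
  using integrable_Y[OF quadratic_growth_quadratic[of 1 0 0], of u] by simp

text \<open>The mean of \<open>\<bar>Y m\<bar>\<close> has order \<open>sqrt m\<close>, seen from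
  \<open>\<bar>x\<bar> \<le> (x\<^sup>2 / r + r) / 2\<close> with the balancing choice
  \<open>r = sqrt m\<close>; division by \<open>m\<close> leaves a vanishing error.\<close>

lemma expectation_abs_G_minus_limit_le:
  fixes n :: nat
  assumes "0 \<le> s"
  defines "m \<equiv> real (Suc n)"
  shows "(\<integral>\<omega>. \<bar>G \<alpha> c (s + m) (Y m \<omega>) - c\<bar> \<partial>M) \<le>
    (\<bar>c\<bar> * cosh \<alpha> + y\<^sup>2) * inverse m + sqrt (inverse m)"
proof -
  define r where "r = sqrt m"
  define a where "a = \<bar>c\<bar> * cosh \<alpha>"
  have m: "1 \<le> m"
    by (simp add: m_def)
  then have r: "1 \<le> r" "r * r = m"
    by (simp_all add: r_def)
  have int: "integrable M (\<lambda>\<omega>. \<bar>G \<alpha> c (s + m) (Y m \<omega>) - c\<bar>)"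
    using m integrable_Y[OF quadratic_growth_G, of m] by simp
  have pointwise: "\<bar>G \<alpha> c (s + m) x - c\<bar> \<le> (a + (x\<^sup>2 / r + r) / 2) / m" for x
  proof -
    have "0 \<le> (\<bar>x\<bar> - r)\<^sup>2 / r"
      using r by simp
    also have "(\<bar>x\<bar> - r)\<^sup>2 / r = x\<^sup>2 / r + r - 2 * \<bar>x\<bar>"
      using r by (simp add: power2_diff field_simps power2_eq_square[of r])
    finally have x: "\<bar>x\<bar> \<le> (x\<^sup>2 / r + r) / 2"
      by simp
    have "\<bar>G \<alpha> c (s + m) x - c\<bar> \<le> (a + \<bar>x\<bar>) / (1 + (s + m))"
      unfolding a_def using assms(1) m by (intro abs_G_minus_limit_le) simp
    also have "\<dots> \<le> (a + (x\<^sup>2 / r + r) / 2) / m"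
    proof (rule frac_le)
      show "a + \<bar>x\<bar> \<le> a + (x\<^sup>2 / r + r) / 2"
        using x by simp
      then show "0 \<le> a + (x\<^sup>2 / r + r) / 2"
        by (rule order_trans[rotated]) (simp add: a_def cosh_real_nonneg)
    qed (use m assms(1) in auto)
    finally show ?thesis .
  qed
  have "(\<integral>\<omega>. \<bar>G \<alpha> c (s + m) (Y m \<omega>) - c\<bar> \<partial>M) \<le> (\<integral>\<omega>. (a + ((Y m \<omega>)\<^sup>2 / r + r) / 2) / m \<partial>M)"
    using m pointwise integrable_Y_square[of m] by (intro integral_mono int) auto
  also have "\<dots> = (a + ((y\<^sup>2 + m) / r + r) / 2) / m"
    using m integrable_Y_square[of m] expectation_square[of m] prob_space by simp
  also have "\<dots> \<le> (a + y\<^sup>2) / m + 1 / r"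
  proof -
    have "(y\<^sup>2 + m) / r = y\<^sup>2 / r + r"
      using r by (simp add: add_divide_distrib flip: r(2))
    moreover have "y\<^sup>2 / r \<le> y\<^sup>2 / 1"
      using r by (intro divide_left_mono) auto
    moreover have "0 \<le> y\<^sup>2"
      by simp
    ultimately have "a + ((y\<^sup>2 + m) / r + r) / 2 \<le> (a + y\<^sup>2) + r"
      by argo
    then have "(a + ((y\<^sup>2 + m) / r + r) / 2) / m \<le> ((a + y\<^sup>2) + r) / m"
      using m by (intro divide_right_mono) auto
    also have "\<dots> = (a + y\<^sup>2) / m + 1 / r"
      using r by (simp add: add_divide_distrib flip: r(2))
    finally show ?thesis .
  qed
  finally show ?thesis
    by (simp add: a_def r_def divide_inverse real_sqrt_inverse)
qed

text \<open>Grid roundings of \<open>\<sigma>\<close> have expected gain at most \<open>B\<close>.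
  Along each path their gains converge by continuity, and the second moment bound from
  \<open>potential\<close> allows the passage to the limit.\<close>

lemma expectation_stopped_gain_le:
  assumes \<sigma>: "stopping_time (natural_filtration (space M) Y) \<sigma>" and s: "0 \<le> s"
    and B: "\<And>h k. 0 < h \<Longrightarrow> bellman \<alpha> c h k s y \<le> B"
  shows "(\<integral>\<omega>. stopped_gain \<alpha> c Y s \<sigma> \<omega> \<partial>M) \<le> B"
proof -
  define h where "h n = 1 / real (Suc n)" for n
  \<comment> \<open>With \<open>(Suc n)\<^sup>2\<close> steps of length \<open>1 / Suc n\<close> the
    mesh tends to 0 while the horizon \<open>Suc n\<close> tends to infinity.\<close>
  define N where "N n = (Suc n)\<^sup>2" for n
  define \<kappa> where "\<kappa> n \<omega> = (LEAST k. k = N n \<or> \<sigma> \<omega> \<le> ennreal (real k * h n))" for n \<omega>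
  define D where "D n \<omega> = G \<alpha> c (s + real (\<kappa> n \<omega>) * h n) (Y (real (\<kappa> n \<omega>) * h n) \<omega>)" for n \<omega>
  define \<Psi> where "\<Psi> n \<omega> = potential \<alpha> (s + real (\<kappa> n \<omega>) * h n) (Y (real (\<kappa> n \<omega>) * h n) \<omega>)" for n \<omega>
  \<comment> \<open>Unlike \<open>D n\<close>, which collects the gain at the horizon when
    \<open>\<sigma>\<close> is later, \<open>X n\<close> takes the limit value \<open>c\<close>
    there and so converges pointwise even where \<open>\<sigma>\<close> is infinite.\<close>
  define X where "X n \<omega> = (if \<sigma> \<omega> \<le> ennreal (real (Suc n)) then D n \<omega> else c)" for n \<omega>
  have h: "0 < h n" for n
    by (simp add: h_def)
  have Nh: "real (N n) * h n = real (Suc n)" for n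
    by (simp only: N_def h_def of_nat_power) (simp add: power2_eq_square del: of_nat_Suc)
  have \<kappa>_pred: "Measurable.pred (natural_filtration (space M) Y (ennreal (real k * h n))) (\<lambda>\<omega>. \<kappa> n \<omega> \<le> k)" for n k
    unfolding \<kappa>_def using h[of n] stopping_timeD[OF \<sigma>] by (intro pred_Least_le) auto
  have \<kappa>_le: "\<kappa> n \<omega> \<le> N n" for n \<omega>
    unfolding \<kappa>_def by (rule Least_grid(1)[OF h])
  have \<kappa>_last: "\<kappa> n \<omega> = N n" if "\<not> \<sigma> \<omega> \<le> ennreal (real (Suc n))" for n \<omega>
    using that unfolding \<kappa>_def Nh[symmetric] by (rule Least_grid(2)[OF h])
  have s_pos: "0 \<le> s + real k * h n" for k n
    using s h[of n] by simp
  have D_int: "integrable M (D n)" for n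
    unfolding D_def by (rule integrable_at_stopping[OF h \<kappa>_pred quadratic_growth_G \<kappa>_le])
  have \<Psi>_int: "integrable M (\<Psi> n)" for n
    unfolding \<Psi>_def by (rule integrable_at_stopping[OF h \<kappa>_pred quadratic_growth_potential \<kappa>_le])
  have D_le: "(\<integral>\<omega>. D n \<omega> \<partial>M) \<le> B" for n
  proof -
    \<comment> \<open>At grid index \<open>k\<close> there remain \<open>N n - k\<close> steps, so
      the recursion makes \<open>U\<close> superharmonic.\<close>
    define U where "U k = bellman \<alpha> c (h n) (N n - k) (s + real k * h n)" for k
    have "(\<integral>\<omega>. D n \<omega> \<partial>M) \<le> U 0 y"
      unfolding D_def
    proof (rule expectation_stopped_le[OF h \<kappa>_pred \<kappa>_le])
      show "quadratic_growth (U k)" for k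
        unfolding U_def using h s_pos by (rule quadratic_growth_bellman)
      show "heat (h n) (U (Suc k)) x \<le> U k x" if "k < N n" for k x
      proof -
        have "N n - k = Suc (N n - Suc k)" "s + real (Suc k) * h n = s + real k * h n + h n"
          using that by (simp_all add: algebra_simps)
        then show ?thesis
          unfolding U_def by (simp add: add.assoc)
      qed
    qed (auto simp: U_def G_le_bellman quadratic_growth_G)
    also have "\<dots> \<le> B"
      unfolding U_def using B[OF h] by simp
    finally show ?thesis .
  qed
  have \<Psi>_le: "(\<integral>\<omega>. \<Psi> n \<omega> \<partial>M) \<le> potential \<alpha> s y" for n
  proof -
    define U where "U k = potential \<alpha> (s + real k * h n)" for k
    have "(\<integral>\<omega>. U (\<kappa> n \<omega>) (Y (real (\<kappa> n \<omega>) * h n) \<omega>) \<partial>M) \<le> U 0 y"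
    proof (rule expectation_stopped_le[OF h \<kappa>_pred \<kappa>_le])
      show "heat (h n) (U (Suc k)) x \<le> U k x" for k x
        using heat_potential_le[OF h s_pos, of n \<alpha> k n x] by (simp add: U_def algebra_simps)
    qed (simp_all add: U_def quadratic_growth_potential)
    then show ?thesis
      by (simp add: U_def \<Psi>_def)
  qed
  have [measurable]: "Measurable.pred M (\<lambda>\<omega>. \<sigma> \<omega> \<le> t)" for t
    using stopping_timeD[OF \<sigma>] by (rule pred_natural_filtration)
  have D_meas [measurable]: "D n \<in> borel_measurable M" for n
    using D_int by (rule borel_measurable_integrable)
  have X_meas [measurable]: "X n \<in> borel_measurable M" for n
    unfolding X_def by measurable
  have X_square: "(X n \<omega>)\<^sup>2 \<le> 2 * c\<^sup>2 + 2 * \<Psi> n \<omega>" for n \<omega>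
    using G_square_le[OF s_pos] potential_nonneg[OF s_pos] by (simp add: X_def D_def \<Psi>_def)
  have bound_int: "integrable M (\<lambda>\<omega>. 2 * c\<^sup>2 + 2 * \<Psi> n \<omega>)" for n
    using \<Psi>_int by simp
  have X_int: "integrable M (\<lambda>\<omega>. (X n \<omega>)\<^sup>2)" for n
    by (rule Bochner_Integration.integrable_bound[OF bound_int]) (use X_square in \<open>auto intro!: AE_I2 intro: order_trans[OF _ abs_ge_self]\<close>)
  have X_K: "(\<integral>\<omega>. (X n \<omega>)\<^sup>2 \<partial>M) \<le> 2 * c\<^sup>2 + 2 * potential \<alpha> s y" for n
  proof -
    have "(\<integral>\<omega>. (X n \<omega>)\<^sup>2 \<partial>M) \<le> (\<integral>\<omega>. 2 * c\<^sup>2 + 2 * \<Psi> n \<omega> \<partial>M)"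
      by (rule integral_mono[OF X_int bound_int X_square])
    also have "\<dots> = 2 * c\<^sup>2 + 2 * (\<integral>\<omega>. \<Psi> n \<omega> \<partial>M)"
      using \<Psi>_int prob_space by simp
    finally show ?thesis
      using \<Psi>_le[of n] by simp
  qed
  define \<epsilon> where "\<epsilon> n = (\<bar>c\<bar> * cosh \<alpha> + y\<^sup>2) * inverse (real (Suc n)) + sqrt (inverse (real (Suc n)))" for n
  have X_le: "(\<integral>\<omega>. X n \<omega> \<partial>M) \<le> B + \<epsilon> n" for n
  proof -
    let ?E = "\<lambda>\<omega>. \<bar>G \<alpha> c (s + real (Suc n)) (Y (real (Suc n)) \<omega>) - c\<bar>"
    have E_int: "integrable M ?E"
      using integrable_Y[OF quadratic_growth_G, of "real (Suc n)"] by simp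
    have "(\<integral>\<omega>. X n \<omega> \<partial>M) \<le> (\<integral>\<omega>. D n \<omega> + ?E \<omega> \<partial>M)"
    proof (rule integral_mono)
      show "integrable M (X n)"
        using X_int by (rule square_integrable_imp_integrable[rotated]) simp
      show "integrable M (\<lambda>\<omega>. D n \<omega> + ?E \<omega>)"
        using D_int E_int by (rule Bochner_Integration.integrable_add)
      \<comment> \<open>The two differ only beyond the horizon, where \<open>\<kappa>\<close> is at
        the cap and \<open>?E\<close> is exactly their distance.\<close>
      show "X n \<omega> \<le> D n \<omega> + ?E \<omega>" for \<omega>
        using \<kappa>_last[of \<omega> n] unfolding X_def D_def by (auto simp: Nh simp del: of_nat_Suc)
    qed
    also have "\<dots> = (\<integral>\<omega>. D n \<omega> \<partial>M) + (\<integral>\<omega>. ?E \<omega> \<partial>M)"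
      using D_int E_int by (rule Bochner_Integration.integral_add)
    finally show ?thesis
      using D_le[of n] expectation_abs_G_minus_limit_le[OF s, of \<alpha> c n] unfolding \<epsilon>_def by linarith
  qed
  have \<epsilon>: "\<epsilon> \<longlonglongrightarrow> 0"
  proof -
    have "\<epsilon> \<longlonglongrightarrow> (\<bar>c\<bar> * cosh \<alpha> + y\<^sup>2) * 0 + sqrt 0"
      unfolding \<epsilon>_def
      by (intro tendsto_add tendsto_mult tendsto_const tendsto_real_sqrt LIMSEQ_inverse_real_of_nat)
    then show ?thesis
      by simp
  qed
  have X_lim: "(\<lambda>n. X n \<omega>) \<longlonglongrightarrow> stopped_gain \<alpha> c Y s \<sigma> \<omega>" if \<omega>: "\<omega> \<in> space M" for \<omega>
  proof (cases "\<sigma> \<omega> = \<infinity>")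
    case True
    then have "X n \<omega> = c" for n
      by (simp add: X_def top_unique)
    then show ?thesis
      using True by (simp add: stopped_gain_def)
  next
    case False
    define t where "t = enn2real (\<sigma> \<omega>)"
    have t: "\<sigma> \<omega> = ennreal t" "0 \<le> t"
      using False by (simp_all add: t_def less_top)
    have late: "\<forall>\<^sub>F n in sequentially. t \<le> real (Suc n)"
      using eventually_ge_at_top[of "nat \<lceil>t\<rceil>"] by eventually_elim linarith
    have grid: "t \<le> real (\<kappa> n \<omega>) * h n \<and> real (\<kappa> n \<omega>) * h n \<le> t + h n" if "t \<le> real (Suc n)" for n
      unfolding \<kappa>_def using t that by (intro Least_grid(3)[OF h]) (simp_all add: Nh del: of_nat_Suc)
    have grid_nonneg: "0 \<le> real (\<kappa> n \<omega>) * h n" for n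
      using h[of n] by simp
    have "(\<lambda>n. t + h n) \<longlonglongrightarrow> t + 0"
      unfolding h_def by (intro tendsto_add tendsto_const lim_1_over_n[THEN LIMSEQ_Suc])
    then have upper: "(\<lambda>n. t + h n) \<longlonglongrightarrow> t"
      by simp
    have "(\<lambda>n. real (\<kappa> n \<omega>) * h n) \<longlonglongrightarrow> t"
    proof (rule tendsto_sandwich[OF _ _ tendsto_const upper])
      show "\<forall>\<^sub>F n in sequentially. t \<le> real (\<kappa> n \<omega>) * h n"
        using late by eventually_elim (rule grid[THEN conjunct1])
      show "\<forall>\<^sub>F n in sequentially. real (\<kappa> n \<omega>) * h n \<le> t + h n"
        using late by eventually_elim (rule grid[THEN conjunct2])
    qed
    moreover have "continuous_on {0..} (\<lambda>u. G \<alpha> c (s + u) (Y u \<omega>))"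
    proof -
      have "continuous_on {0..} (\<lambda>u. f \<alpha> (s + u))"
        using s by (intro continuous_on_compose2[OF continuous_f]) (auto intro!: continuous_intros)
      moreover have "f \<alpha> (s + u) \<noteq> 0" if "u \<in> {0..}" for u
        using f_pos[of "s + u" \<alpha>] that s by simp
      ultimately show ?thesis
        unfolding G_def using continuous_paths[OF \<omega>] by (intro continuous_intros) auto
    qed
    ultimately have D_lim: "(\<lambda>n. D n \<omega>) \<longlonglongrightarrow> G \<alpha> c (s + t) (Y t \<omega>)"
      unfolding D_def using t(2) grid_nonneg
      by (intro continuous_on_tendsto_compose[of "{0..}" "\<lambda>u. G \<alpha> c (s + u) (Y u \<omega>)"]) auto
    have "\<forall>\<^sub>F n in sequentially. D n \<omega> = X n \<omega>"
      using late by eventually_elim (simp add: X_def t ennreal_leI del: of_nat_Suc)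
    with D_lim have "(\<lambda>n. X n \<omega>) \<longlonglongrightarrow> G \<alpha> c (s + t) (Y t \<omega>)"
      by (rule Lim_transform_eventually)
    then show ?thesis
      using False by (simp add: stopped_gain_def t_def)
  qed
  show ?thesis
    by (rule expectation_limit_le[OF X_lim X_meas X_int X_K X_le \<epsilon>])
qed

text \<open>The optimal rule stops at the first grid time at which the value does not exceed the
  gain. Before that time the maximum in the recursion is the average; at the cap, value and gain
  coincide.\<close>

lemma bellman_attained:
  assumes h: "0 < h" and s: "0 \<le> s"
  shows "\<exists>\<sigma>. stopping_time (natural_filtration (space M) Y) \<sigma> \<and>
    (\<integral>\<omega>. stopped_gain \<alpha> c Y s \<sigma> \<omega> \<partial>M) = bellman \<alpha> c h N s y"
proof -
  define g where "g k = G \<alpha> c (s + real k * h)" for k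
  define U where "U k = bellman \<alpha> c h (N - k) (s + real k * h)" for k
  define \<kappa> where "\<kappa> \<omega> = (LEAST k. k = N \<or> U k (Y (real k * h) \<omega>) \<le> g k (Y (real k * h) \<omega>))" for \<omega>
  define \<sigma> where "\<sigma> \<omega> = ennreal (real (\<kappa> \<omega>) * h)" for \<omega>
  have g: "quadratic_growth (g k)" for k
    unfolding g_def by (rule quadratic_growth_G)
  have U: "quadratic_growth (U k)" for k
    unfolding U_def using h s by (intro quadratic_growth_bellman) auto
  have g_le_U: "g k x \<le> U k x" for k x
    unfolding g_def U_def by (rule G_le_bellman)
  have \<kappa>_pred: "Measurable.pred (natural_filtration (space M) Y (ennreal (real k * h))) (\<lambda>\<omega>. \<kappa> \<omega> \<le> k)" for k
    unfolding \<kappa>_def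
  proof (rule pred_Least_le)
    fix k
    have [measurable]: "g k \<in> borel_measurable borel" "U k \<in> borel_measurable borel"
      using g U by (auto intro: quadratic_growth_measurable)
    have [measurable]: "Y (real k * h) \<in> borel_measurable (natural_filtration (space M) Y (ennreal (real k * h)))"
      using h by (intro measurable_natural_filtration) auto
    show "Measurable.pred (natural_filtration (space M) Y (ennreal (real k * h)))
        (\<lambda>\<omega>. U k (Y (real k * h) \<omega>) \<le> g k (Y (real k * h) \<omega>))"
      by measurable
  qed (use h in simp)
  have \<kappa>_le: "\<kappa> \<omega> \<le> N" for \<omega>
    unfolding \<kappa>_def by (rule Least_le) simp
  have "stopping_time (natural_filtration (space M) Y) \<sigma>"
    unfolding stopping_time_def
  proof
    fix t
    let ?F = "natural_filtration (space M) Y t"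
    \<comment> \<open>Only finitely many grid times occur, and each event on the right is known at
      its grid time, hence by \<open>t\<close>. This form also covers infinite
      \<open>t\<close>.\<close>
    have "(\<lambda>\<omega>. \<sigma> \<omega> \<le> t) = (\<lambda>\<omega>. \<exists>k\<in>{k. k \<le> N \<and> ennreal (real k * h) \<le> t}. \<kappa> \<omega> \<le> k)"
    proof (rule ext, rule iffI)
      fix \<omega>
      show "\<exists>k\<in>{k. k \<le> N \<and> ennreal (real k * h) \<le> t}. \<kappa> \<omega> \<le> k" if "\<sigma> \<omega> \<le> t"
        using that \<kappa>_le[of \<omega>] unfolding \<sigma>_def by blast
      assume "\<exists>k\<in>{k. k \<le> N \<and> ennreal (real k * h) \<le> t}. \<kappa> \<omega> \<le> k"
      then obtain k where k: "ennreal (real k * h) \<le> t" "\<kappa> \<omega> \<le> k"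
        by blast
      have "\<sigma> \<omega> \<le> ennreal (real k * h)"
        unfolding \<sigma>_def using k(2) h by (intro ennreal_leI mult_right_mono) auto
      then show "\<sigma> \<omega> \<le> t"
        using k(1) by (rule order_trans)
    qed
    moreover have "Measurable.pred ?F (\<lambda>\<omega>. \<exists>k\<in>{k. k \<le> N \<and> ennreal (real k * h) \<le> t}. \<kappa> \<omega> \<le> k)"
      by (rule pred_intros_finite) (auto intro: pred_natural_filtration_mono[OF \<kappa>_pred])
    ultimately show "Measurable.pred ?F (\<lambda>\<omega>. \<sigma> \<omega> \<le> t)"
      by (simp only:)
  qed
  moreover have "(\<integral>\<omega>. g (\<kappa> \<omega>) (Y (real (\<kappa> \<omega>) * h) \<omega>) \<partial>M) = U 0 y"
  proof (rule expectation_stopped_eq[OF h \<kappa>_pred \<kappa>_le g U])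
    fix \<omega>
    have "\<kappa> \<omega> = N \<or> U (\<kappa> \<omega>) (Y (real (\<kappa> \<omega>) * h) \<omega>) \<le> g (\<kappa> \<omega>) (Y (real (\<kappa> \<omega>) * h) \<omega>)"
      unfolding \<kappa>_def by (rule LeastI[of _ N]) simp
    moreover have "U N x = g N x" for x
      by (simp add: U_def g_def)
    ultimately show "U (\<kappa> \<omega>) (Y (real (\<kappa> \<omega>) * h) \<omega>) = g (\<kappa> \<omega>) (Y (real (\<kappa> \<omega>) * h) \<omega>)"
      using g_le_U by (metis order_antisym)
  next
    fix k \<omega> assume k: "k < \<kappa> \<omega>"
    then have "\<not> (k = N \<or> U k (Y (real k * h) \<omega>) \<le> g k (Y (real k * h) \<omega>))"
      unfolding \<kappa>_def by (rule not_less_Least)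
    moreover have "N - k = Suc (N - Suc k)" "s + real (Suc k) * h = s + real k * h + h"
      using k \<kappa>_le[of \<omega>] by (simp_all add: algebra_simps)
    ultimately show "heat h (U (Suc k)) (Y (real k * h) \<omega>) = U k (Y (real k * h) \<omega>)"
      by (simp add: U_def g_def add.assoc)
  qed
  moreover have "stopped_gain \<alpha> c Y s \<sigma> = (\<lambda>\<omega>. g (\<kappa> \<omega>) (Y (real (\<kappa> \<omega>) * h) \<omega>))"
    using h by (simp add: fun_eq_iff stopped_gain_def \<sigma>_def g_def)
  ultimately show ?thesis
    by (auto simp: U_def)
qed

text \<open>Attained grid values bound the supremum from below; if all of them are at most
  \<open>G\<close>, rounding bounds it from above by \<open>G\<close>.\<close>

lemma SUP_stopped_gain_eq_G_iff:
  assumes "0 \<le> s"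
  shows "(SUP \<sigma>\<in>{\<sigma>. stopping_time (natural_filtration (space M) Y) \<sigma>}.
      ereal (\<integral>\<omega>. stopped_gain \<alpha> c Y s \<sigma> \<omega> \<partial>M)) = ereal (G \<alpha> c s y) \<longleftrightarrow>
    (\<forall>h>0. \<forall>k. bellman \<alpha> c h k s y \<le> G \<alpha> c s y)" (is "?S = _ \<longleftrightarrow> _")
proof
  have lower: "ereal (bellman \<alpha> c h k s y) \<le> ?S" if h: "0 < h" for h k
  proof -
    obtain \<sigma> where "stopping_time (natural_filtration (space M) Y) \<sigma>"
        "(\<integral>\<omega>. stopped_gain \<alpha> c Y s \<sigma> \<omega> \<partial>M) = bellman \<alpha> c h k s y"
      using bellman_attained[OF h assms] by blast
    then show ?thesis
      by (intro SUP_upper2[of \<sigma>]) auto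
  qed
  show "\<forall>h>0. \<forall>k. bellman \<alpha> c h k s y \<le> G \<alpha> c s y" if "?S = ereal (G \<alpha> c s y)"
    using lower unfolding that by simp
  assume *: "\<forall>h>0. \<forall>k. bellman \<alpha> c h k s y \<le> G \<alpha> c s y"
  show "?S = ereal (G \<alpha> c s y)"
  proof (rule antisym)
    show "?S \<le> ereal (G \<alpha> c s y)"
      using expectation_stopped_gain_le[OF _ assms] * by (intro SUP_least) auto
    \<comment> \<open>With no remaining steps the grid rule stops at once.\<close>
    show "ereal (G \<alpha> c s y) \<le> ?S"
      using lower[of 1 0] by simp
  qed
qed

end

section \<open>The stopping boundary\<close>

theorem proposition2:
  fixes \<alpha> c :: real
    and A :: "'a measure"
    and P :: "real \<Rightarrow> 'a measure"
    and Y :: "real \<Rightarrow> 'a \<Rightarrow> real"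
  assumes "\<alpha> \<noteq> 0"
    and "\<And>y. sets (P y) = sets A"
    and "\<And>y. brownian_motion (P y) Y y"
  shows "\<exists>b :: real \<Rightarrow> real.
    stopping_set P Y \<alpha> c = {(s, y). 0 \<le> s \<and> y \<ge> b s} \<and>
    (\<forall>s\<ge>0. c * (f \<alpha> s - s * deriv (f \<alpha>) s) / deriv (f \<alpha>) s < b s)"
proof -
  \<comment> \<open>A section of the stopping set, described without reference to the measures
    \<open>P y\<close>.\<close>
  define S where "S s = {y. \<forall>h>0. \<forall>k. bellman \<alpha> c h k s y \<le> G \<alpha> c s y}" for s
  define b where "b s = Inf (S s)" for s
  define d where "d s = c * (f \<alpha> s - s * deriv (f \<alpha>) s) / deriv (f \<alpha>) s" for s
  have mem: "(s, y) \<in> stopping_set P Y \<alpha> c \<longleftrightarrow> 0 \<le> s \<and> y \<in> S s" for s y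
    using brownian_motion.SUP_stopped_gain_eq_G_iff[OF assms(3)[of y], where s = s and \<alpha> = \<alpha> and c = c]
    by (auto simp: stopping_set_def W_def S_def)
  have up: "y' \<in> S s" if "0 \<le> s" "y \<in> S s" "y \<le> y'" for s y y'
    unfolding S_def
  proof (intro CollectI allI impI)
    fix h :: real and k :: nat assume h: "0 < h"
    have "bellman \<alpha> c h k s y' - bellman \<alpha> c h k s y \<le> inverse (f \<alpha> s) * (y' - y)"
      using bellman_slope[OF h that(1,3)] by simp
    also have "\<dots> = G \<alpha> c s y' - G \<alpha> c s y"
      by (simp add: G_diff divide_inverse mult.commute)
    finally have "bellman \<alpha> c h k s y' - bellman \<alpha> c h k s y \<le> G \<alpha> c s y' - G \<alpha> c s y" .
    moreover have "bellman \<alpha> c h k s y \<le> G \<alpha> c s y"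
      using that(2) h by (simp add: S_def)
    ultimately show "bellman \<alpha> c h k s y' \<le> G \<alpha> c s y'"
      by linarith
  qed
  have ray: "S s = {b s..}" and above: "d s < b s" if s: "0 \<le> s" for s
  proof -
    have "d s \<notin> S s"
    proof -
      obtain h where "0 < h" "G \<alpha> c s (d s) < bellman \<alpha> c h 2 s (d s)"
        using continue_at_zero_drift[OF s d_def] by blast
      then show ?thesis
        by (auto simp: S_def not_le)
    qed
    \<comment> \<open>A member at or below \<open>d s\<close> would put \<open>d s\<close> itself in
      the upward closed section.\<close>
    then have lower: "d s < y" if "y \<in> S s" for y
      using up[OF s that, of "d s"] by (auto simp: not_less[symmetric])
    have "S s \<noteq> {}"
      using stop_far_up[OF s, of \<alpha> c] by (auto simp: S_def)
    moreover have bdd: "bdd_below (S s)"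
      using lower by (intro bdd_belowI[of _ "d s"] less_imp_le)
    moreover have "closed (S s)"
    proof -
      have "closed {y. bellman \<alpha> c h k s y \<le> G \<alpha> c s y}" if "0 < h" for h k
        using that s by (intro closed_Collect_le continuous_bellman) (auto simp: G_affine intro!: continuous_intros)
      moreover have "S s = (\<Inter>h\<in>{0<..}. \<Inter>k. {y. bellman \<alpha> c h k s y \<le> G \<alpha> c s y})"
        by (auto simp: S_def)
      ultimately show ?thesis
        by (auto intro!: closed_INT)
    qed
    \<comment> \<open>Closedness puts the infimum in the section; this makes both the ray closed and
      the bound \<open>d s < b s\<close> strict.\<close>
    ultimately have inf: "b s \<in> S s"
      unfolding b_def by (rule closed_contains_Inf)
    then show "d s < b s"
      by (rule lower)
    show "S s = {b s..}"
      using up[OF s inf] cInf_lower[OF _ bdd] by (auto simp: b_def)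
  qed
  have "stopping_set P Y \<alpha> c = {(s, y). 0 \<le> s \<and> y \<ge> b s}"
    using mem ray by auto
  moreover have "\<forall>s\<ge>0. c * (f \<alpha> s - s * deriv (f \<alpha>) s) / deriv (f \<alpha>) s < b s"
    using above unfolding d_def by blast
  ultimately show ?thesis
    by blast
qed

end
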